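(* Consider the problem $\min_{\mathbf{x}\in\mathbb{R}^n}\{f_0(\mathbf{x}):=g(\mathbf{x})+h(\mathbf{x})\ \text{ s.t. }\ \mathbf{A}\mathbf{x}=\mathbf{b},\ \mathbf{f}(\mathbf{x})\le\mathbf{0}\}$, where $g$ is continuously differentiable (possibly nonconvex), $h$ is closed convex (possibly nonsmooth), $\mathbf{A}\in\mathbb{R}^{l\times n}$, $\mathbf{b}\in\mathbb{R}^l$, and $\mathbf{f}=(f_1,\dots,f_m):\mathbb{R}^n\to\mathbb{R}^m$ with each $f_j$ convex and $L_j^f$-smooth. Suppose: (1) $g$ is $L_0$-smooth and $\rho_0$-weakly convex; (2) $h$ is a simple closed convex function with compact domain, i.e. $D:=\max_{\mathbf{x},\mathbf{x}'\in\mathrm{dom}(h)}\|\mathbf{x}-\mathbf{x}'\|<\infty$; (3) there is some $v>0$ such that for any $k\ge1$ the iterates $\mathbf{x}^k$ and penalty parameters $\beta_{k-1}$ of the algorithm iALM (defined in the context) satisfy $$v\sqrt{\|\mathbf{A}\mathbf{x}^k-\mathbf{b}\|^2+\|[\mathbf{f}(\mathbf{x}^k)]_+\|^2}\le\mathrm{dist}\Big(-\mathbf{A}^\top(\mathbf{A}\mathbf{x}^k-\mathbf{b})-J_f(\mathbf{x}^k)^\top[\mathbf{f}(\mathbf{x}^k)]_+,\ \tfrac{1}{\beta_{k-1}}\partial h(\mathbf{x}^k)\Big).$$ Given $\varepsilon>0$, the algorithm iALM needs $\tilde O(\varepsilon^{-5/2})$ APG iterations (in total) to produce an $\varepsilon$-KKT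 solution of the problem.
   Context: Norms are Euclidean (spectral for matrices); $\mathrm{dist}(\mathbf{x},\mathcal{X})=\min_{\mathbf{y}\in\mathcal{X}}\|\mathbf{x}-\mathbf{y}\|$; $[\mathbf{a}]_+$ is the componentwise positive part; $J_f(\mathbf{x})$ is the Jacobian of $\mathbf{f}$ at $\mathbf{x}$; $\partial f_0=\nabla g+\partial h$ with $\partial h$ the convex subdifferential. A differentiable $f$ is $L$-smooth if $\|\nabla f(\mathbf{x}_1)-\nabla f(\mathbf{x}_2)\|\le L\|\mathbf{x}_1-\mathbf{x}_2\|$ for all $\mathbf{x}_1,\mathbf{x}_2\in\mathbb{R}^n$; $f$ is $\rho$-weakly convex if $f+\frac{\rho}{2}\|\cdot\|^2$ is convex. $\tilde O$ is the big-$O$ (as $\varepsilon\to0$) suppressing all logarithmic factors of $\varepsilon$; the hidden constants may depend on the problem data, $\mathbf{x}^0$, the algorithm parameters $\beta_0,\sigma,w_0$, and $v$, but not on $\varepsilon$. $\varepsilon$-KKT point (solution): $\mathbf{x}\in\mathbb{R}^n$ such that there exist $\mathbf{y}\in\mathbb{R}^l$ and $\mathbf{z}\in\mathbb{R}^m$ with $\|\mathbf{A}\mathbf{x}-\mathbf{b}\|\le\varepsilon$, $\mathrm{dist}(\mathbf{0},\partial f_0(\mathbf{x})+\mathbf{A}^\top\mathbf{y}+J_f(\mathbf{x})^\top\mathbf{z})\le\varepsilon$, and $\sum_{i=1}^m|z_if_i(\mathbf{x})|\le\varepsilon$. Augmented Lagrangian, with multiplier $\mathbf{p}=(\mathbf{y};\mathbf{z})$: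 $\mathcal{L}_\beta(\mathbf{x},\mathbf{p})=f_0(\mathbf{x})+\mathbf{y}^\top(\mathbf{A}\mathbf{x}-\mathbf{b})+\frac{\beta}{2}\|\mathbf{A}\mathbf{x}-\mathbf{b}\|^2+\frac{1}{2\beta}\big(\|[\mathbf{z}+\beta\mathbf{f}(\mathbf{x})]_+\|^2-\|\mathbf{z}\|^2\big)$. Constants: $B_i^f=\max_{\mathbf{x}\in\mathrm{dom}(h)}\max\{|f_i(\mathbf{x})|,\|\nabla f_i(\mathbf{x})\|\}$ for $i\in\{1,\dots,m\}$. Subroutine APG$(G,H,\mu,L_G,\epsilon)$ (for $G$ $\mu$-strongly convex and $L_G$-smooth, $H$ closed convex): choose $\bar{\mathbf{x}}^{-1}\in\mathrm{dom}(H)$, set $\alpha=\sqrt{\mu/L_G}$ and $\bar{\mathbf{x}}^0=\mathbf{x}^0=\arg\min_{\mathbf{x}}\langle\nabla G(\bar{\mathbf{x}}^{-1}),\mathbf{x}\rangle+\frac{L_G}{2}\|\mathbf{x}-\bar{\mathbf{x}}^{-1}\|^2+H(\mathbf{x})$. For $t=0,1,\dots$ (each $t$ is one APG iteration): $\mathbf{x}^{t+1}=\arg\min_{\mathbf{x}}\langle\nabla G(\bar{\mathbf{x}}^{t}),\mathbf{x}\rangle+\frac{L_G}{2}\|\mathbf{x}-\bar{\mathbf{x}}^{t}\|^2+H(\mathbf{x})$, $\bar{\mathbf{x}}^{t+1}=\mathbf{x}^{t+1}+\frac{1-\alpha}{1+\alpha}(\mathbf{x}^{t+1}-\mathbf{x}^t)$;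 if $\mathrm{dist}(-\nabla G(\mathbf{x}^{t+1}),\partial H(\mathbf{x}^{t+1}))\le\epsilon$, output $\mathbf{x}^{t+1}$ and stop. Subroutine iPPM$(\phi,\psi,\mathbf{x}^0,\rho,L_\phi,\varepsilon)$: for $k=0,1,\dots$: let $G(\cdot)=\phi(\cdot)+\rho\|\cdot-\mathbf{x}^k\|^2$; set $\mathbf{x}^{k+1}\leftarrow$ APG$(G,\psi,\rho,L_\phi+2\rho,\frac{\varepsilon}{4})$; if $2\rho\|\mathbf{x}^{k+1}-\mathbf{x}^k\|\le\frac{\varepsilon}{2}$, return $\mathbf{x}^{k+1}$. Algorithm iALM: choose $\mathbf{x}^0\in\mathrm{dom}(f_0)$, $\mathbf{y}^0=\mathbf{0}$, $\mathbf{z}^0=\mathbf{0}$, $\beta_0>0$, $\sigma>1$, $w_0>0$. For $k=0,1,\dots$: let $\beta_k=\beta_0\sigma^k$, $\mathbf{p}^k=(\mathbf{y}^k;\mathbf{z}^k)$, $\phi(\cdot)=\mathcal{L}_{\beta_k}(\cdot,\mathbf{p}^k)-h(\cdot)$, and $\hat L_k=L_0+\beta_k\|\mathbf{A}^\top\mathbf{A}\|+\sum_{i=1}^m\big(\beta_kB_i^f(B_i^f+L_i^f)+L_i^f|z_i^k|\big)$; set $\mathbf{x}^{k+1}\leftarrow$ iPPM$(\phi,h,\mathbf{x}^k,\rho_0,\hat L_k,\varepsilon)$; update $\mathbf{y}^{k+1}=\mathbf{y}^k+w_k(\mathbf{A}\mathbf{x}^{k+1}-\mathbf{b})$ and $z_i^{k+1}=z_i^k+w_k\max\{-z_i^k/\beta_k,\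 f_i(\mathbf{x}^{k+1})\}$ for $i=1,\dots,m$, where $$w_k=w_0\min\Big\{1,\ \frac{\gamma_k}{\max\{\|\mathbf{A}\mathbf{x}^{k+1}-\mathbf{b}\|,\|[\mathbf{f}(\mathbf{x}^{k+1})]_+\|\}},\ \frac{\beta_k}{w_0}\Big\},\qquad \gamma_k=\frac{(\log2)^2\min\{\|\mathbf{A}\mathbf{x}^0-\mathbf{b}\|,\|[\mathbf{f}(\mathbf{x}^0)]_+\|\}}{(k+1)[\log(k+2)]^2}.$$ The APG iterations are counted over all calls of APG made by all calls of iPPM.
   Formalization: Added assumption: in every APG call made, G is L_G-smooth (L_G = L̂_k+2ρ_0) on the convex hull of dom(h) and the extrapolated points visited; without it APG may never stop, since B_i^f is a maximum over dom(h) only. *)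

theory Defs
  imports "HOL-Analysis.Analysis" "HOL-Library.Extended_Nat" "HOL-Library.Landau_Symbols"
begin

section \<open>Convex-analytic notions\<close>

definition grad :: "('a::real_inner \<Rightarrow> real) \<Rightarrow> 'a \<Rightarrow> 'a" where
  "grad F x = (THE D. GDERIV F x :> D)"

definition L_smooth_on :: "real \<Rightarrow> 'a set \<Rightarrow> ('a::real_inner \<Rightarrow> real) \<Rightarrow> bool" where
  "L_smooth_on L S F \<longleftrightarrow>
     (\<forall>x\<in>S. F differentiable at x) \<and>
     (\<forall>x\<in>S. \<forall>y\<in>S. norm (grad F x - grad F y) \<le> L * norm (x - y))"

definition weakly_convex :: "real \<Rightarrow> ('a::real_inner \<Rightarrow> real) \<Rightarrow> bool" where
  "weakly_convex \<rho> F \<longleftrightarrow> convex_on UNIV (\<lambda>x. F x + \<rho> / 2 * (norm x)\<^sup>2)"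

definition edom :: "('a \<Rightarrow> ereal) \<Rightarrow> 'a set" where
  "edom H = {x. H x < \<infinity>}"

text \<open>Proper closed convex extended-valued functions, through the epigraph.\<close>

definition closed_convex_fun :: "('a::real_normed_vector \<Rightarrow> ereal) \<Rightarrow> bool" where
  "closed_convex_fun H \<longleftrightarrow>
     (\<forall>x. H x \<noteq> -\<infinity>) \<and> edom H \<noteq> {} \<and>
     convex {(x, r::real). H x \<le> ereal r} \<and> closed {(x, r::real). H x \<le> ereal r}"

definition subdiff :: "('a::real_inner \<Rightarrow> ereal) \<Rightarrow> 'a \<Rightarrow> 'a set" where
  "subdiff H x = {s. x \<in> edom H \<and> (\<forall>y. H x + ereal (s \<bullet> (y - x)) \<le> H y)}"

text \<open>Unlike \<^const>\<open>infdist\<close>, the distance to the empty set is \<open>\<infinity>\<close>; this matters because a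
  subdifferential can be empty on the boundary of the domain.\<close>

definition dist_set :: "'a::real_normed_vector \<Rightarrow> 'a set \<Rightarrow> ereal" where
  "dist_set x X = (INF y\<in>X. ereal (norm (x - y)))"

definition pos_part :: "real ^ 'n \<Rightarrow> real ^ 'n" where
  "pos_part a = (\<chi> i. max 0 (a $ i))"

section \<open>The problem, KKT points, the augmented Lagrangian\<close>

text \<open>Problem data: minimise \<open>g + h\<close> subject to \<open>A x = b\<close>, \<open>f x \<le> 0\<close>, together with the
  smoothness and weak convexity constants, which enter the algorithm.\<close>

record ('n, 'l, 'm) problem =
  obj_g :: "real ^ 'n \<Rightarrow> real"
  obj_h :: "real ^ 'n \<Rightarrow> ereal"
  mat_A :: "real ^ 'n ^ 'l"
  vec_b :: "real ^ 'l"
  con_f :: "real ^ 'n \<Rightarrow> real ^ 'm"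
  L0 :: real
  rho0 :: real
  Lf :: "'m \<Rightarrow> real"

definition eq_res :: "('n::finite, 'l::finite, 'm::finite) problem \<Rightarrow> real ^ 'n \<Rightarrow> real ^ 'l" where
  "eq_res P x = mat_A P *v x - vec_b P"

definition Jf :: "('n::finite, 'l::finite, 'm::finite) problem \<Rightarrow> real ^ 'n \<Rightarrow> real ^ 'n ^ 'm" where
  "Jf P x = jacobian (con_f P) (at x)"

definition eps_KKT :: "('n::finite, 'l::finite, 'm::finite) problem \<Rightarrow> real \<Rightarrow> real ^ 'n \<Rightarrow> bool" where
  "eps_KKT P \<epsilon> x \<longleftrightarrow>
     (\<exists>y z. norm (eq_res P x) \<le> \<epsilon> \<and>
        dist_set 0 ((\<lambda>s. grad (obj_g P) x + s + transpose (mat_A P) *v y + transpose (Jf P x) *v z)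
                      ` subdiff (obj_h P) x) \<le> ereal \<epsilon> \<and>
        (\<Sum>i\<in>UNIV. \<bar>z $ i * con_f P x $ i\<bar>) \<le> \<epsilon>)"

text \<open>The part of the augmented Lagrangian added to the objective \<open>g + h\<close>.\<close>

definition al_penalty :: "('n::finite, 'l::finite, 'm::finite) problem \<Rightarrow> real \<Rightarrow>
    real ^ 'l \<Rightarrow> real ^ 'm \<Rightarrow> real ^ 'n \<Rightarrow> real" where
  "al_penalty P \<beta> y z x =
     y \<bullet> eq_res P x + \<beta> / 2 * (norm (eq_res P x))\<^sup>2
     + 1 / (2 * \<beta>) * ((norm (pos_part (z + \<beta> *\<^sub>R con_f P x)))\<^sup>2 - (norm z)\<^sup>2)"

definition aug_lagrangian :: "('n::finite, 'l::finite, 'm::finite) problem \<Rightarrow> real \<Rightarrow>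
    real ^ 'l \<Rightarrow> real ^ 'm \<Rightarrow> real ^ 'n \<Rightarrow> ereal" where
  "aug_lagrangian P \<beta> y z x = (ereal (obj_g P x) + obj_h P x) + ereal (al_penalty P \<beta> y z x)"

text \<open>The augmented Lagrangian minus \<open>h\<close>, see \<open>al_smooth_eq\<close>; outside the domain of \<open>h\<close>, where
  the difference is \<open>\<infinity> - \<infinity>\<close>, it is the same formula in \<open>g\<close>, \<open>A\<close>, \<open>b\<close>, \<open>f\<close>. The
  extrapolated points of APG may lie there.\<close>

definition al_smooth :: "('n::finite, 'l::finite, 'm::finite) problem \<Rightarrow> real \<Rightarrow>
    real ^ 'l \<Rightarrow> real ^ 'm \<Rightarrow> real ^ 'n \<Rightarrow> real" where
  "al_smooth P \<beta> y z x = obj_g P x + al_penalty P \<beta> y z x"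

lemma al_smooth_eq:
  assumes "closed_convex_fun (obj_h P)" "x \<in> edom (obj_h P)"
  shows "ereal (al_smooth P \<beta> y z x) = aug_lagrangian P \<beta> y z x - obj_h P x"
proof (cases "obj_h P x")
  case (real r)
  then show ?thesis by (simp add: al_smooth_def aug_lagrangian_def)
qed (use assms in \<open>auto simp: closed_convex_fun_def edom_def\<close>)

definition Bf :: "('n::finite, 'l::finite, 'm::finite) problem \<Rightarrow> 'm \<Rightarrow> real" where
  "Bf P i = (SUP x\<in>edom (obj_h P).
     max \<bar>con_f P x $ i\<bar> (norm (grad (\<lambda>x. con_f P x $ i) x)))"

section \<open>Subroutine APG\<close>

definition prox_step :: "('a::real_inner \<Rightarrow> real) \<Rightarrow> ('a \<Rightarrow> ereal) \<Rightarrow> real \<Rightarrow> 'a \<Rightarrow> 'a" where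
  "prox_step G H L u =
     arg_min (\<lambda>x. ereal (grad G u \<bullet> x + L / 2 * (norm (x - u))\<^sup>2) + H x) (\<lambda>_. True)"

text \<open>The pair of the \<open>t\<close>-th iterate and the \<open>t\<close>-th extrapolated point, without stopping, when
  APG is started from the point \<open>s\<close>.\<close>

primrec apg_seq :: "('a::real_inner \<Rightarrow> real) \<Rightarrow> ('a \<Rightarrow> ereal) \<Rightarrow> real \<Rightarrow> real \<Rightarrow> 'a \<Rightarrow> nat \<Rightarrow> 'a \<times> 'a" where
  "apg_seq G H \<mu> L s 0 = (prox_step G H L s, prox_step G H L s)"
| "apg_seq G H \<mu> L s (Suc t) =
     (let (x, u) = apg_seq G H \<mu> L s t;
          \<alpha> = sqrt (\<mu> / L);
          x' = prox_step G H L u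
      in (x', x' + ((1 - \<alpha>) / (1 + \<alpha>)) *\<^sub>R (x' - x)))"

text \<open>Number of APG iterations of a call; it is \<open>\<infinity>\<close>, the infimum of the empty set, if the
  stopping test never succeeds. The output is meaningful only if it is finite, and likewise
  for the other two loops below.\<close>

definition apg_count :: "('a::real_inner \<Rightarrow> real) \<Rightarrow> ('a \<Rightarrow> ereal) \<Rightarrow> real \<Rightarrow> real \<Rightarrow> real \<Rightarrow> 'a \<Rightarrow> enat" where
  "apg_count G H \<mu> L \<epsilon> s =
     Inf (enat ` {N. 1 \<le> N \<and>
       (let x = fst (apg_seq G H \<mu> L s N) in dist_set (- grad G x) (subdiff H x) \<le> ereal \<epsilon>)})"

definition apg_out :: "('a::real_inner \<Rightarrow> real) \<Rightarrow> ('a \<Rightarrow> ereal) \<Rightarrow> real \<Rightarrow> real \<Rightarrow> real \<Rightarrow> 'a \<Rightarrow> 'a" where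
  "apg_out G H \<mu> L \<epsilon> s = fst (apg_seq G H \<mu> L s (the_enat (apg_count G H \<mu> L \<epsilon> s)))"

text \<open>APG requires \<open>G\<close> to be \<open>L\<close>-smooth. Here this is required only on the convex hull of the
  domain of \<open>H\<close> and of the extrapolated points that the call visits; all points at which the
  call evaluates the gradient of \<open>G\<close> belong to this set.\<close>

definition apg_smooth_input ::
    "('a::real_inner \<Rightarrow> real) \<Rightarrow> ('a \<Rightarrow> ereal) \<Rightarrow> real \<Rightarrow> real \<Rightarrow> real \<Rightarrow> 'a \<Rightarrow> bool" where
  "apg_smooth_input G H \<mu> L \<epsilon> s \<longleftrightarrow>
     L_smooth_on L
       (convex hull (edom H \<union> {snd (apg_seq G H \<mu> L s t) |t. enat t < apg_count G H \<mu> L \<epsilon> s})) G"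

section \<open>Subroutine iPPM\<close>

text \<open>The freely chosen starting points of the successive APG calls are given by a sequence \<open>s\<close>.\<close>

definition ippm_G :: "('a::real_inner \<Rightarrow> real) \<Rightarrow> real \<Rightarrow> 'a \<Rightarrow> 'a \<Rightarrow> real" where
  "ippm_G \<phi> \<rho> u x = \<phi> x + \<rho> * (norm (x - u))\<^sup>2"

primrec ippm_seq :: "('a::real_inner \<Rightarrow> real) \<Rightarrow> ('a \<Rightarrow> ereal) \<Rightarrow> 'a \<Rightarrow> real \<Rightarrow> real \<Rightarrow> real \<Rightarrow>
    (nat \<Rightarrow> 'a) \<Rightarrow> nat \<Rightarrow> 'a" where
  "ippm_seq \<phi> \<psi> x0 \<rho> L \<epsilon> s 0 = x0"
| "ippm_seq \<phi> \<psi> x0 \<rho> L \<epsilon> s (Suc j) =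
     apg_out (ippm_G \<phi> \<rho> (ippm_seq \<phi> \<psi> x0 \<rho> L \<epsilon> s j)) \<psi> \<rho> (L + 2 * \<rho>) (\<epsilon> / 4) (s j)"

definition ippm_apg_count :: "('a::real_inner \<Rightarrow> real) \<Rightarrow> ('a \<Rightarrow> ereal) \<Rightarrow> 'a \<Rightarrow> real \<Rightarrow> real \<Rightarrow> real \<Rightarrow>
    (nat \<Rightarrow> 'a) \<Rightarrow> nat \<Rightarrow> enat" where
  "ippm_apg_count \<phi> \<psi> x0 \<rho> L \<epsilon> s j =
     apg_count (ippm_G \<phi> \<rho> (ippm_seq \<phi> \<psi> x0 \<rho> L \<epsilon> s j)) \<psi> \<rho> (L + 2 * \<rho>) (\<epsilon> / 4) (s j)"

definition ippm_calls :: "('a::real_inner \<Rightarrow> real) \<Rightarrow> ('a \<Rightarrow> ereal) \<Rightarrow> 'a \<Rightarrow> real \<Rightarrow> real \<Rightarrow> real \<Rightarrow>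
    (nat \<Rightarrow> 'a) \<Rightarrow> enat" where
  "ippm_calls \<phi> \<psi> x0 \<rho> L \<epsilon> s =
     Inf (enat ` {J. 1 \<le> J \<and>
       2 * \<rho> * norm (ippm_seq \<phi> \<psi> x0 \<rho> L \<epsilon> s J - ippm_seq \<phi> \<psi> x0 \<rho> L \<epsilon> s (J - 1)) \<le> \<epsilon> / 2})"

definition ippm_out :: "('a::real_inner \<Rightarrow> real) \<Rightarrow> ('a \<Rightarrow> ereal) \<Rightarrow> 'a \<Rightarrow> real \<Rightarrow> real \<Rightarrow> real \<Rightarrow>
    (nat \<Rightarrow> 'a) \<Rightarrow> 'a" where
  "ippm_out \<phi> \<psi> x0 \<rho> L \<epsilon> s =
     ippm_seq \<phi> \<psi> x0 \<rho> L \<epsilon> s (the_enat (ippm_calls \<phi> \<psi> x0 \<rho> L \<epsilon> s))"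

definition ippm_cost :: "('a::real_inner \<Rightarrow> real) \<Rightarrow> ('a \<Rightarrow> ereal) \<Rightarrow> 'a \<Rightarrow> real \<Rightarrow> real \<Rightarrow> real \<Rightarrow>
    (nat \<Rightarrow> 'a) \<Rightarrow> enat" where
  "ippm_cost \<phi> \<psi> x0 \<rho> L \<epsilon> s =
     (case ippm_calls \<phi> \<psi> x0 \<rho> L \<epsilon> s of
        enat J \<Rightarrow> (\<Sum>j<J. ippm_apg_count \<phi> \<psi> x0 \<rho> L \<epsilon> s j)
      | \<infinity> \<Rightarrow> \<infinity>)"

text \<open>Every APG call that is actually made receives an input as required; the \<open>j\<close>-th call is
  made if iPPM has not returned before and all earlier calls have terminated.\<close>

definition ippm_smooth_inputs :: "('a::real_inner \<Rightarrow> real) \<Rightarrow> ('a \<Rightarrow> ereal) \<Rightarrow> 'a \<Rightarrow> real \<Rightarrow> real \<Rightarrow>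
    real \<Rightarrow> (nat \<Rightarrow> 'a) \<Rightarrow> bool" where
  "ippm_smooth_inputs \<phi> \<psi> x0 \<rho> L \<epsilon> s \<longleftrightarrow>
     (\<forall>j. enat j < ippm_calls \<phi> \<psi> x0 \<rho> L \<epsilon> s \<longrightarrow>
          (\<forall>i<j. ippm_apg_count \<phi> \<psi> x0 \<rho> L \<epsilon> s i \<noteq> \<infinity>) \<longrightarrow>
          apg_smooth_input (ippm_G \<phi> \<rho> (ippm_seq \<phi> \<psi> x0 \<rho> L \<epsilon> s j)) \<psi> \<rho> (L + 2 * \<rho>) (\<epsilon> / 4) (s j))"

section \<open>Algorithm iALM\<close>

record 'n params =
  x_init :: "real ^ 'n"
  beta0 :: real
  sigma :: real
  w0 :: real

definition beta :: "'n::finite params \<Rightarrow> nat \<Rightarrow> real" where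
  "beta Q k = beta0 Q * sigma Q ^ k"

definition Lhat :: "('n::finite, 'l::finite, 'm::finite) problem \<Rightarrow> real \<Rightarrow> real ^ 'm \<Rightarrow> real" where
  "Lhat P \<beta> z =
     L0 P + \<beta> * onorm ((*v) (transpose (mat_A P) ** mat_A P))
     + (\<Sum>i\<in>UNIV. \<beta> * Bf P i * (Bf P i + Lf P i) + Lf P i * \<bar>z $ i\<bar>)"

definition gamma :: "('n::finite, 'l::finite, 'm::finite) problem \<Rightarrow> 'n params \<Rightarrow> nat \<Rightarrow> real" where
  "gamma P Q k =
     (ln 2)\<^sup>2 * min (norm (eq_res P (x_init Q))) (norm (pos_part (con_f P (x_init Q))))
     / (real (k + 1) * (ln (real (k + 2)))\<^sup>2)"

text \<open>The step size \<open>w\<^sub>k\<close> for the new iterate \<open>x\<close>. If \<open>x\<close> is feasible, then the quotient with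
  numerator \<open>\<gamma>\<^sub>k\<close> has denominator 0; it is read as \<open>\<infinity>\<close>, so that it drops out of the minimum.\<close>

definition step_w :: "('n::finite, 'l::finite, 'm::finite) problem \<Rightarrow> 'n params \<Rightarrow> nat \<Rightarrow>
    real ^ 'n \<Rightarrow> real" where
  "step_w P Q k x =
     (let d = max (norm (eq_res P x)) (norm (pos_part (con_f P x)))
      in w0 Q * (if d = 0 then min 1 (beta Q k / w0 Q)
                 else min 1 (min (gamma P Q k / d) (beta Q k / w0 Q))))"

text \<open>The state \<open>(x\<^sup>k, y\<^sup>k, z\<^sup>k)\<close>; \<open>s k j\<close> is the starting point of the \<open>j\<close>-th APG call within the
  \<open>k\<close>-th call of iPPM. Universal quantification over \<open>s\<close> covers all ways to choose these points.\<close>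

primrec ialm :: "('n::finite, 'l::finite, 'm::finite) problem \<Rightarrow> 'n params \<Rightarrow> real \<Rightarrow>
    (nat \<Rightarrow> nat \<Rightarrow> real ^ 'n) \<Rightarrow> nat \<Rightarrow> (real ^ 'n) \<times> (real ^ 'l) \<times> (real ^ 'm)" where
  "ialm P Q \<epsilon> s 0 = (x_init Q, 0, 0)"
| "ialm P Q \<epsilon> s (Suc k) =
     (let (x, y, z) = ialm P Q \<epsilon> s k;
          \<beta> = beta Q k;
          x' = ippm_out (al_smooth P \<beta> y z) (obj_h P) x (rho0 P) (Lhat P \<beta> z) \<epsilon> (s k);
          w = step_w P Q k x'
      in (x', y + w *\<^sub>R eq_res P x',
          \<chi> i. z $ i + w * max (- (z $ i) / \<beta>) (con_f P x' $ i)))"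

definition ialm_x :: "('n::finite, 'l::finite, 'm::finite) problem \<Rightarrow> 'n params \<Rightarrow> real \<Rightarrow>
    (nat \<Rightarrow> nat \<Rightarrow> real ^ 'n) \<Rightarrow> nat \<Rightarrow> real ^ 'n" where
  "ialm_x P Q \<epsilon> s k = fst (ialm P Q \<epsilon> s k)"

text \<open>Total number of APG iterations spent until \<open>x\<^sup>K\<close> is produced; it is \<open>\<infinity>\<close> iff the algorithm
  gets stuck in a subroutine and never produces \<open>x\<^sup>K\<close>.\<close>

definition ialm_cost :: "('n::finite, 'l::finite, 'm::finite) problem \<Rightarrow> 'n params \<Rightarrow> real \<Rightarrow>
    (nat \<Rightarrow> nat \<Rightarrow> real ^ 'n) \<Rightarrow> nat \<Rightarrow> enat" where
  "ialm_cost P Q \<epsilon> s K =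
     (\<Sum>k<K. let (x, y, z) = ialm P Q \<epsilon> s k; \<beta> = beta Q k
        in ippm_cost (al_smooth P \<beta> y z) (obj_h P) x (rho0 P) (Lhat P \<beta> z) \<epsilon> (s k))"

text \<open>The constant \<^const>\<open>Lhat\<close> is a Lipschitz constant on the domain of \<open>h\<close>, because
  \<^const>\<open>Bf\<close> bounds \<open>f\<close> there only. So the input requirement of APG has content exactly where
  extrapolated points leave this domain.\<close>

definition ialm_smooth_inputs :: "('n::finite, 'l::finite, 'm::finite) problem \<Rightarrow> 'n params \<Rightarrow> real \<Rightarrow>
    (nat \<Rightarrow> nat \<Rightarrow> real ^ 'n) \<Rightarrow> bool" where
  "ialm_smooth_inputs P Q \<epsilon> s \<longleftrightarrow>
     (\<forall>k. ialm_cost P Q \<epsilon> s k \<noteq> \<infinity> \<longrightarrow>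
        (let (x, y, z) = ialm P Q \<epsilon> s k; \<beta> = beta Q k
         in ippm_smooth_inputs (al_smooth P \<beta> y z) (obj_h P) x (rho0 P) (Lhat P \<beta> z) \<epsilon> (s k)))"

section \<open>Regularity and complexity\<close>

definition regular_at :: "('n::finite, 'l::finite, 'm::finite) problem \<Rightarrow> real \<Rightarrow> real \<Rightarrow>
    real ^ 'n \<Rightarrow> bool" where
  "regular_at P v \<beta> x \<longleftrightarrow>
     ereal (v * sqrt ((norm (eq_res P x))\<^sup>2 + (norm (pos_part (con_f P x)))\<^sup>2))
     \<le> dist_set (- (transpose (mat_A P) *v eq_res P x)
                   - transpose (Jf P x) *v pos_part (con_f P x))
                 ((\<lambda>s. (1 / \<beta>) *\<^sub>R s) ` subdiff (obj_h P) x)"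

text \<open>Big-O as \<open>\<epsilon>\<close> tends to 0 from the right, up to logarithmic factors of \<open>\<epsilon>\<close>.\<close>

definition soft_O :: "(real \<Rightarrow> real) \<Rightarrow> (real \<Rightarrow> real) set" where
  "soft_O r = {T. \<exists>p::nat. T \<in> O[at_right 0](\<lambda>\<epsilon>. r \<epsilon> * ln (1 / \<epsilon>) ^ p)}"

end

theory Submission
  imports Defs "HOL-Real_Asymp.Real_Asymp"
begin

text \<open>
  The proof multiplies three bounds: the number of outer iterations, the number of proximal point
  steps in each of them, and the number of APG iterations in each of those.

  \<^emph>\<open>Outer iterations.\<close> The step sizes make the increments of the multipliers summable, so the
  multipliers stay bounded (\<open>good_multipliers_update\<close>). Each call of iPPM returns an
  \<open>\<epsilon>\<close>-stationary point of the augmented Lagrangian. In its stationarity condition only the terms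
  \<open>\<beta> A\<^sup>T (A x - b)\<close>, \<open>\<beta> J\<^sup>T [f]\<^sub>+\<close> and the subgradient of \<open>h\<close> can be large, and the regularity
  condition bounds the norm of their sum from below by \<open>\<beta> v\<close> times the residual. So the residual is
  \<open>O(1 / \<beta>)\<close> (\<open>residual_bound\<close>), with a constant independent of \<open>\<beta>\<close> and, for
  bounded \<open>\<epsilon>\<close>, of \<open>\<epsilon>\<close>, and so is the violation of complementarity (\<open>eps_KKT_if_penalty_large\<close>). Since
  \<open>\<beta>\<close> grows geometrically, \<open>O(log (1 / \<epsilon>))\<close> iterations suffice, and
  \<open>\<beta> = O(1 / \<epsilon>)\<close> throughout.

  \<^emph>\<open>Proximal point steps.\<close> Every step that does not pass the stopping test decreases the augmented
  Lagrangian by a multiple of \<open>\<epsilon>\<^sup>2\<close> (\<open>sufficient_decrease\<close>). The total decrease possible is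
  bounded independently of \<open>\<beta>\<close>, because the starting point, being the previous outer iterate, has
  residual \<open>O(1 / \<beta>)\<close> (\<open>good_state_gap\<close>). So there are \<open>O(\<epsilon>\<^sup>-\<^sup>2)\<close> steps.

  \<^emph>\<open>APG iterations.\<close> The subproblems are \<open>\<rho>\<close>-strongly convex, since for convex constraints the
  penalty term is convex (\<open>al_penalty_above_tangent\<close>), and by the input requirement of APG they
  are \<open>L\<close>-smooth with \<open>L = O(\<beta>) = O(1 / \<epsilon>)\<close> where gradients are evaluated. Nesterov's potential shrinks by the factor
  \<open>1 - sqrt (\<rho> / L)\<close> per iteration (\<open>potential_contraction\<close>), so that a call takes
  \<open>O(sqrt (1 / \<epsilon>) log (1 / \<epsilon>))\<close> iterations (\<open>apg_terminates\<close>).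

  As a closed convex function with compact domain, \<open>h\<close> is bounded below but it may be unbounded
  above. An upper bound is therefore established only along the iterates
  (\<open>h_bound_at_stationary\<close>), and the potential of APG is bounded initially through the starting
  proximal step and not through function values.
\<close>

section \<open>Gradients and convexity\<close>

lemma GDERIV_unique:
  assumes "GDERIV F x :> d" "GDERIV F x :> e"
  shows "d = e"
proof -
  have "(\<lambda>h. h \<bullet> d) = (\<lambda>h. h \<bullet> e)"
    using assms has_derivative_unique unfolding gderiv_def by blast
  then have "(d - e) \<bullet> d = (d - e) \<bullet> e" by meson
  then have "(d - e) \<bullet> (d - e) = 0" by (simp add: inner_diff_right)
  then show ?thesis by simp
qed

lemma grad_eqI: "GDERIV F x :> d \<Longrightarrow> grad F x = d"
  unfolding grad_def using GDERIV_unique by blast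

lemma GDERIV_grad:
  fixes F :: "'a::euclidean_space \<Rightarrow> real"
  assumes "F differentiable at x"
  shows "GDERIV F x :> grad F x"
proof -
  obtain F' where F': "FDERIV F x :> F'" using assms unfolding differentiable_def by blast
  then have "linear F'" by (rule has_derivative_linear)
  then have "F' h = h \<bullet> (\<Sum>b\<in>Basis. F' b *\<^sub>R b)" for h
    by (subst euclidean_representation[symmetric, of h])
       (simp add: linear_sum linear_cmul inner_sum_right mult.commute del: euclidean_representation)
  then have "F' = (\<lambda>h. h \<bullet> (\<Sum>b\<in>Basis. F' b *\<^sub>R b))" by (rule ext)
  with F' have "GDERIV F x :> (\<Sum>b\<in>Basis. F' b *\<^sub>R b)" unfolding gderiv_def by metis
  then show ?thesis by (simp add: grad_eqI)
qed

lemma GDERIV_norm_sq: "GDERIV (\<lambda>x. c * (norm (x - u))\<^sup>2) x :> (2 * c) *\<^sub>R (x - u)"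
proof -
  have "((\<lambda>x. c * ((x - u) \<bullet> (x - u))) has_derivative
      (\<lambda>h. c * ((x - u) \<bullet> h + h \<bullet> (x - u)))) (at x)"
    by (auto intro!: derivative_eq_intros)
  then show ?thesis
    unfolding gderiv_def power2_norm_eq_inner by (simp add: inner_commute algebra_simps)
qed

lemma GDERIV_along_line:
  assumes "GDERIV F (x + t *\<^sub>R d) :> g"
  shows "((\<lambda>t. F (x + t *\<^sub>R d)) has_real_derivative g \<bullet> d) (at t)"
proof -
  have "((\<lambda>t. x + t *\<^sub>R d) has_derivative (\<lambda>h. h *\<^sub>R d)) (at t)"
    by (auto intro!: derivative_eq_intros)
  from has_derivative_compose[OF this assms[unfolded gderiv_def]]
  have "((\<lambda>t. F (x + t *\<^sub>R d)) has_derivative (\<lambda>h. (h *\<^sub>R d) \<bullet> g)) (at t)" .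
  moreover have "(\<lambda>h. (h *\<^sub>R d) \<bullet> g) = (*) (g \<bullet> d)" by (auto simp: inner_commute)
  ultimately show ?thesis by (simp add: has_field_derivative_def)
qed

text \<open>First-order optimality is needed in the form of a one-sided derivative at the end point of
  a segment.\<close>

lemma deriv_nonneg_of_min_at_0:
  fixes f :: "real \<Rightarrow> real"
  assumes f: "(f has_real_derivative d) (at 0)"
    and min: "\<And>t. 0 < t \<Longrightarrow> t \<le> 1 \<Longrightarrow> f 0 \<le> f t"
  shows "0 \<le> d"
proof (rule ccontr)
  assume "\<not> 0 \<le> d"
  then obtain e where e: "e > 0" "\<And>h. 0 < h \<Longrightarrow> h < e \<Longrightarrow> f (0 + h) < f 0"
    using DERIV_neg_dec_right[OF f] by auto
  have "0 < min 1 (e/2)" "min 1 (e/2) \<le> 1" "min 1 (e/2) < e" using e(1) by auto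
  note m = this
  have "f 0 \<le> f (min 1 (e/2))" by (rule min[OF m(1,2)])
  also have "\<dots> < f 0" using e(2)[OF m(1,3)] unfolding add_0 .
  finally show False by simp
qed

lemma convex_above_tangent:
  assumes conv: "convex_on UNIV F" and F: "GDERIV F x :> g"
  shows "F x + g \<bullet> (y - x) \<le> F y"
proof -
  define f where "f t = F x + t * (F y - F x) - F (x + t *\<^sub>R (y - x))" for t :: real
  have "(f has_real_derivative (F y - F x) - g \<bullet> (y - x)) (at 0)"
    unfolding f_def using GDERIV_along_line[of F x 0 "y - x" g] F by (auto intro!: derivative_eq_intros)
  moreover have "f 0 \<le> f t" if "0 < t" "t \<le> 1" for t
    using convex_onD[OF conv, of t x y] that by (simp add: f_def algebra_simps)
  ultimately have "0 \<le> (F y - F x) - g \<bullet> (y - x)" by (rule deriv_nonneg_of_min_at_0)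
  then show ?thesis by simp
qed

text \<open>For differentiable functions, weak convexity is used only through this quadratic lower
  bound; negative \<open>\<mu>\<close> encode weak, positive \<open>\<mu>\<close> strong convexity.\<close>

definition quad_below :: "real \<Rightarrow> ('a::real_inner \<Rightarrow> real) \<Rightarrow> bool" where
  "quad_below \<mu> F \<longleftrightarrow> (\<forall>x y. F x + grad F x \<bullet> (y - x) + \<mu> / 2 * (norm (y - x))\<^sup>2 \<le> F y)"

lemma norm_sq_expand:
  fixes x y :: "'a::real_inner"
  shows "(norm (y - u))\<^sup>2 = (norm (x - u))\<^sup>2 + 2 * ((x - u) \<bullet> (y - x)) + (norm (y - x))\<^sup>2"
  unfolding power2_norm_eq_inner by (simp add: inner_diff inner_commute)

lemma weakly_convex_imp_quad_below:
  fixes F :: "'a::euclidean_space \<Rightarrow> real"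
  assumes "weakly_convex \<rho> F" and diff: "\<And>x. F differentiable at x"
  shows "quad_below (- \<rho>) F"
  unfolding quad_below_def
proof (intro allI)
  fix x y :: 'a
  have "GDERIV (\<lambda>x. F x + \<rho>/2 * (norm x)\<^sup>2) x :> grad F x + \<rho> *\<^sub>R x"
    using GDERIV_add[OF GDERIV_grad[OF diff] GDERIV_norm_sq[of "\<rho>/2" 0]] by simp
  from convex_above_tangent[OF assms(1)[unfolded weakly_convex_def] this, of y]
  have "F x + \<rho>/2 * (norm x)\<^sup>2 + grad F x \<bullet> (y - x) + \<rho> * (x \<bullet> (y - x)) \<le> F y + \<rho>/2 * (norm y)\<^sup>2"
    by (simp add: inner_add_left)
  also have "\<rho>/2 * (norm y)\<^sup>2 = \<rho>/2 * (norm x)\<^sup>2 + \<rho> * (x \<bullet> (y - x)) + \<rho>/2 * (norm (y - x))\<^sup>2"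
    using arg_cong[OF norm_sq_expand[of y 0 x], of "(*) (\<rho>/2)"] by (simp add: distrib_left)
  finally show "F x + grad F x \<bullet> (y - x) + - \<rho> / 2 * (norm (y - x))\<^sup>2 \<le> F y" by simp
qed

lemma quad_below_add_norm_sq:
  fixes F :: "'a::euclidean_space \<Rightarrow> real"
  assumes qb: "quad_below \<mu> F" and diff: "\<And>x. F differentiable at x"
  shows "quad_below (\<mu> + 2 * c) (\<lambda>x. F x + c * (norm (x - u))\<^sup>2)"
  unfolding quad_below_def
proof (intro allI)
  fix x y :: 'a
  have g: "grad (\<lambda>x. F x + c * (norm (x - u))\<^sup>2) x = grad F x + (2 * c) *\<^sub>R (x - u)"
    by (intro grad_eqI GDERIV_add GDERIV_grad diff GDERIV_norm_sq)
  have "F x + grad F x \<bullet> (y - x) + \<mu> / 2 * (norm (y - x))\<^sup>2 \<le> F y"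
    using qb unfolding quad_below_def by blast
  moreover have "c * (norm (y - u))\<^sup>2 = c * (norm (x - u))\<^sup>2 + 2 * c * ((x - u) \<bullet> (y - x)) + c * (norm (y - x))\<^sup>2"
    using arg_cong[OF norm_sq_expand[of y u x], of "(*) c"] by (simp add: distrib_left)
  ultimately show "F x + c * (norm (x - u))\<^sup>2 + grad (\<lambda>x. F x + c * (norm (x - u))\<^sup>2) x \<bullet> (y - x)
      + (\<mu> + 2 * c) / 2 * (norm (y - x))\<^sup>2 \<le> F y + c * (norm (y - u))\<^sup>2"
    unfolding g by (simp add: inner_add_left add_divide_distrib distrib_right)
qed

lemma quad_below_combination:
  assumes qb: "quad_below \<mu> F" and al: "0 \<le> \<alpha>" "\<alpha> \<le> 1"
  shows "F ((1 - \<alpha>) *\<^sub>R x + \<alpha> *\<^sub>R y)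
    \<le> (1 - \<alpha>) * F x + \<alpha> * F y - \<mu> / 2 * (\<alpha> * (1 - \<alpha>)) * (norm (x - y))\<^sup>2"
proof -
  define w where "w = (1 - \<alpha>) *\<^sub>R x + \<alpha> *\<^sub>R y"
  have xw: "x - w = \<alpha> *\<^sub>R (x - y)" and yw: "y - w = - ((1 - \<alpha>) *\<^sub>R (x - y))"
    by (simp_all add: w_def algebra_simps)
  let ?g = "grad F w \<bullet> (x - y)" and ?n = "(norm (x - y))\<^sup>2"
  have 1: "F w + \<alpha> * ?g + \<mu>/2 * \<alpha>\<^sup>2 * ?n \<le> F x"
    using qb[unfolded quad_below_def, rule_format, of w x] unfolding xw
    by (simp add: power_mult_distrib)
  have 2: "F w - (1 - \<alpha>) * ?g + \<mu>/2 * (1 - \<alpha>)\<^sup>2 * ?n \<le> F y"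
    using qb[unfolded quad_below_def, rule_format, of w y] unfolding yw
    by (simp add: power_mult_distrib)
  have "(1 - \<alpha>) * (F w + \<alpha> * ?g + \<mu>/2 * \<alpha>\<^sup>2 * ?n) + \<alpha> * (F w - (1 - \<alpha>) * ?g + \<mu>/2 * (1 - \<alpha>)\<^sup>2 * ?n)
      \<le> (1 - \<alpha>) * F x + \<alpha> * F y"
    using al by (intro add_mono mult_left_mono 1 2) auto
  also have "(1 - \<alpha>) * (F w + \<alpha> * ?g + \<mu>/2 * \<alpha>\<^sup>2 * ?n) + \<alpha> * (F w - (1 - \<alpha>) * ?g + \<mu>/2 * (1 - \<alpha>)\<^sup>2 * ?n)
     = F w + \<mu>/2 * (\<alpha> * (1 - \<alpha>)) * ?n"
    by (simp add: field_simps power2_eq_square)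
  finally show ?thesis unfolding w_def by simp
qed

text \<open>The descent lemma: a Lipschitz gradient on a convex set bounds the function from above by
  its quadratic model.\<close>

lemma L_smooth_on_upper_bound:
  fixes F :: "'a::euclidean_space \<Rightarrow> real"
  assumes sm: "L_smooth_on L S F" and S: "convex S" "x \<in> S" "y \<in> S"
  shows "F y \<le> F x + grad F x \<bullet> (y - x) + L / 2 * (norm (y - x))\<^sup>2"
proof -
  define d where "d = y - x"
  define f where "f t = F (x + t *\<^sub>R d) - t * (grad F x \<bullet> d) - L/2 * t\<^sup>2 * (norm d)\<^sup>2" for t :: real
  have "f 1 \<le> f 0"
  proof (rule DERIV_nonpos_imp_nonincreasing[of 0 1 f])
    fix t :: real assume t: "0 \<le> t" "t \<le> 1"
    define w where "w = x + t *\<^sub>R d"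
    have w: "w \<in> S"
      using convexD[OF S(1) S(2,3), of "1 - t" t] t by (simp add: w_def d_def algebra_simps)
    have "GDERIV F (x + t *\<^sub>R d) :> grad F w"
      using sm w GDERIV_grad[of F w] by (simp add: w_def L_smooth_on_def)
    from GDERIV_along_line[OF this]
    have "(f has_real_derivative grad F w \<bullet> d - grad F x \<bullet> d - L * t * (norm d)\<^sup>2) (at t)"
      unfolding f_def by (auto intro!: derivative_eq_intros)
    moreover have "grad F w \<bullet> d - grad F x \<bullet> d \<le> L * t * (norm d)\<^sup>2"
    proof -
      have "grad F w \<bullet> d - grad F x \<bullet> d \<le> norm (grad F w - grad F x) * norm d"
        using norm_cauchy_schwarz[of "grad F w - grad F x" d] by (simp add: inner_diff_left)
      also have "\<dots> \<le> (L * norm (w - x)) * norm d"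
        using sm w S(2) unfolding L_smooth_on_def by (intro mult_right_mono) auto
      also have "\<dots> = L * t * (norm d)\<^sup>2" using t by (simp add: w_def power2_eq_square)
      finally show ?thesis .
    qed
    ultimately show "\<exists>y. (f has_real_derivative y) (at t) \<and> y \<le> 0" by fastforce
  qed simp
  then show ?thesis by (simp add: f_def d_def)
qed

section \<open>Closed convex functions with compact domain\<close>

locale compact_convex_fun =
  fixes H :: "'a::euclidean_space \<Rightarrow> ereal"
  assumes closed_convex: "closed_convex_fun H" and compact_dom: "compact (edom H)"
begin

text \<open>Only the values on the domain matter; elsewhere this is the default value \<open>0\<close>.\<close>

definition hr :: "'a \<Rightarrow> real" where "hr x = real_of_ereal (H x)"

lemma H_eq: "x \<in> edom H \<Longrightarrow> H x = ereal (hr x)"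
  using closed_convex by (cases "H x") (auto simp: hr_def edom_def closed_convex_fun_def)

lemma H_outside: "x \<notin> edom H \<Longrightarrow> H x = \<infinity>"
  by (simp add: edom_def)

lemma dom_nonempty: "edom H \<noteq> {}"
  using closed_convex by (simp add: closed_convex_fun_def)

lemma hr_convex_combination:
  assumes x: "x \<in> edom H" and y: "y \<in> edom H" and t: "0 \<le> t" "t \<le> 1"
  shows "(1 - t) *\<^sub>R x + t *\<^sub>R y \<in> edom H"
    and "hr ((1 - t) *\<^sub>R x + t *\<^sub>R y) \<le> (1 - t) * hr x + t * hr y"
proof -
  have conv: "convex {(x, r::real). H x \<le> ereal r}"
    using closed_convex by (simp add: closed_convex_fun_def)
  have "(1 - t) *\<^sub>R (x, hr x) + t *\<^sub>R (y, hr y) \<in> {(x, r::real). H x \<le> ereal r}"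
    by (rule convexD[OF conv]) (use x y t H_eq in auto)
  then have *: "H ((1 - t) *\<^sub>R x + t *\<^sub>R y) \<le> ereal ((1 - t) * hr x + t * hr y)" by simp
  then show dom: "(1 - t) *\<^sub>R x + t *\<^sub>R y \<in> edom H"
    unfolding edom_def mem_Collect_eq by (rule order_le_less_trans) simp
  show "hr ((1 - t) *\<^sub>R x + t *\<^sub>R y) \<le> (1 - t) * hr x + t * hr y"
    using * H_eq[OF dom] by simp
qed

lemma subdiff_iff:
  "s \<in> subdiff H x \<longleftrightarrow> x \<in> edom H \<and> (\<forall>y\<in>edom H. hr x + s \<bullet> (y - x) \<le> hr y)"
proof (cases "x \<in> edom H")
  case True
  have "(H x + ereal (s \<bullet> (y - x)) \<le> H y) \<longleftrightarrow> (y \<in> edom H \<longrightarrow> hr x + s \<bullet> (y - x) \<le> hr y)" for y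
    by (cases "y \<in> edom H") (auto simp: H_eq True H_outside)
  then show ?thesis using True by (auto simp: subdiff_def)
qed (simp add: subdiff_def)

text \<open>\<open>H\<close> need not be continuous on its domain, and it can even be unbounded there. A minimiser
  exists nevertheless: the sublevel sets at the levels attained on the domain are closed, because
  the epigraph is, and they are nested, so compactness of the domain gives a common point.\<close>

lemma minimizer_exists:
  assumes q: "continuous_on UNIV q"
  shows "\<exists>x\<in>edom H. \<forall>y\<in>edom H. q x + hr x \<le> q y + hr y"
proof -
  let ?C = "\<lambda>y. {x. H x \<le> ereal (q y + hr y - q x)}"
  have "edom H \<inter> (\<Inter>y\<in>edom H. ?C y) \<noteq> {}"
  proof (rule compact_imp_fip_image[OF compact_dom])
    fix y
    have "closed ((\<lambda>x. (x, q y + hr y - q x)) -` {(x, r::real). H x \<le> ereal r})"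
      using closed_convex q
      by (intro closed_vimage continuous_intros) (auto simp: closed_convex_fun_def)
    then show "closed (?C y)" by (simp add: vimage_def)
  next
    fix I assume I: "finite I" "I \<subseteq> edom H"
    show "edom H \<inter> (\<Inter>y\<in>I. ?C y) \<noteq> {}"
    proof (cases "I = {}")
      case True
      then show ?thesis using dom_nonempty by simp
    next
      case False
      obtain z where z: "is_arg_min (\<lambda>y. q y + hr y) (\<lambda>y. y \<in> I) z"
        using ex_is_arg_min_if_finite[OF I(1) False] by blast
      then have "z \<in> edom H \<inter> (\<Inter>y\<in>I. ?C y)"
        using I(2) by (auto simp: is_arg_min_def not_less H_eq subset_iff)
      then show ?thesis by blast
    qed
  qed
  then obtain x where x: "x \<in> edom H" "\<forall>y\<in>edom H. H x \<le> ereal (q y + hr y - q x)" by blast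
  have "q x + hr x \<le> q y + hr y" if "y \<in> edom H" for y
    using x that by (auto simp: H_eq)
  with x(1) show ?thesis by blast
qed

lemma hr_bounded_below: "\<exists>m. \<forall>y\<in>edom H. m \<le> hr y"
  using minimizer_exists[of "\<lambda>_. 0"] by auto

text \<open>Fermat's rule for the sum of a differentiable and a convex function.\<close>

lemma optimality_condition:
  assumes x: "x \<in> edom H" and min: "\<And>y. y \<in> edom H \<Longrightarrow> q x + hr x \<le> q y + hr y"
    and q: "GDERIV q x :> g"
  shows "- g \<in> subdiff H x"
  unfolding subdiff_iff
proof (intro conjI x ballI)
  fix y assume y: "y \<in> edom H"
  define f where "f t = q (x + t *\<^sub>R (y - x)) + t * (hr y - hr x)" for t :: real
  have "(f has_real_derivative g \<bullet> (y - x) + (hr y - hr x)) (at 0)"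
    unfolding f_def using GDERIV_along_line[of q x 0 "y - x" g] q by (auto intro!: derivative_eq_intros)
  moreover have "f 0 \<le> f t" if t: "0 < t" "t \<le> 1" for t
  proof -
    have eq: "(1 - t) *\<^sub>R x + t *\<^sub>R y = x + t *\<^sub>R (y - x)" by (simp add: algebra_simps)
    show ?thesis
      using hr_convex_combination[OF x y, of t] min[of "x + t *\<^sub>R (y - x)"] t
      unfolding eq f_def by (simp add: algebra_simps)
  qed
  ultimately have "0 \<le> g \<bullet> (y - x) + (hr y - hr x)" by (rule deriv_nonneg_of_min_at_0)
  then show "hr x + - g \<bullet> (y - x) \<le> hr y" by simp
qed

text \<open>That the minimisation defining the proximal step has a solution is needed for its choice
  operator to mean anything; optimality of the chosen point then follows from Fermat's rule.\<close>

lemma prox_step_subgradient: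
  fixes u :: 'a and G :: "'a \<Rightarrow> real"
  assumes L: "L \<ge> 0"
  defines "x \<equiv> prox_step G H L u"
  shows "- (grad G u + L *\<^sub>R (x - u)) \<in> subdiff H x"
proof -
  define q where "q x = grad G u \<bullet> x + L / 2 * (norm (x - u))\<^sup>2" for x
  define F where "F x = ereal (q x) + H x" for x
  have F_dom: "F z = ereal (q z + hr z)" if "z \<in> edom H" for z using that by (simp add: F_def H_eq)
  obtain z where z: "z \<in> edom H" "\<forall>y\<in>edom H. q z + hr z \<le> q y + hr y"
  proof -
    have "continuous_on UNIV q" unfolding q_def by (intro continuous_intros)
    from minimizer_exists[OF this] that show ?thesis by blast
  qed
  have "is_arg_min F (\<lambda>_. True) z"
    unfolding is_arg_min_def
  proof (intro conjI TrueI notI)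
    assume "\<exists>y. True \<and> F y < F z"
    then obtain y where "F y < F z" by blast
    then show False
      using z F_dom[OF z(1)] F_dom[of y] by (cases "y \<in> edom H") (auto simp: F_def H_outside not_less[symmetric])
  qed
  moreover have "x = arg_min F (\<lambda>_. True)"
    unfolding x_def prox_step_def F_def q_def by simp
  ultimately have x: "is_arg_min F (\<lambda>_. True) x"
    unfolding arg_min_def using someI[of "is_arg_min F (\<lambda>_. True)" z] by simp
  have "\<not> F z < F x" using x by (simp add: is_arg_min_def)
  then have "F x \<noteq> \<infinity>" using F_dom[OF z(1)] by auto
  then have xd: "x \<in> edom H" using H_outside[of x] by (auto simp: F_def)
  have "- (grad G u + (2 * (L / 2)) *\<^sub>R (x - u)) \<in> subdiff H x"
  proof (rule optimality_condition[OF xd])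
    show "q x + hr x \<le> q y + hr y" if "y \<in> edom H" for y
      using x unfolding is_arg_min_def
      by (metis F_dom[OF that] F_dom[OF xd] less_ereal.simps(1) not_less)
    have "GDERIV (\<lambda>x. grad G u \<bullet> x) x :> grad G u"
      unfolding gderiv_def inner_commute[of _ "grad G u"]
      by (rule bounded_linear_imp_has_derivative[OF bounded_linear_inner_right])
    from GDERIV_add[OF this GDERIV_norm_sq]
    show "GDERIV q x :> grad G u + (2 * (L / 2)) *\<^sub>R (x - u)" unfolding q_def .
  qed
  then show ?thesis by simp
qed

lemma prox_step_in_dom: "L \<ge> 0 \<Longrightarrow> prox_step G H L u \<in> edom H"
  using prox_step_subgradient subdiff_iff by blast

end

section \<open>Accelerated proximal gradient\<close>

text \<open>All loop counters below are infima of success times. To bound such a counter it suffices to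
  bound every number strictly below it, and below it the run is known to satisfy the input
  requirements and to have failed the stopping test.\<close>

lemma first_success_bounded:
  assumes bound: "\<And>N. enat N < Inf (enat ` {n. 1 \<le> n \<and> S n}) \<Longrightarrow> real N \<le> B"
  obtains N where "Inf (enat ` {n. 1 \<le> n \<and> S n}) = enat N" "1 \<le> N" "S N" "real N \<le> B + 1"
proof -
  let ?A = "{n. 1 \<le> n \<and> S n}"
  have "?A \<noteq> {}"
  proof
    assume "?A = {}"
    then have "Inf (enat ` ?A) = \<infinity>" by (simp add: Inf_enat_def)
    then have "real (nat \<lceil>B\<rceil> + 1) \<le> B" by (intro bound) simp
    then show False by linarith
  qed
  then obtain k where "enat k \<in> enat ` ?A" by blast
  then have "Inf (enat ` ?A) \<in> enat ` ?A" by (rule wellorder_InfI)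
  then obtain N where N: "Inf (enat ` ?A) = enat N" "N \<in> ?A" by (rule imageE)
  then have N': "1 \<le> N" "S N" by simp_all
  have "enat (N - 1) < Inf (enat ` ?A)" unfolding N(1) using N'(1) by simp
  then have "real (N - 1) \<le> B" by (rule bound)
  then have "real N \<le> B + 1" by linarith
  with N(1) N' show thesis by (rule that)
qed

lemma not_success_before_first:
  assumes "enat N < Inf (enat ` {n. 1 \<le> n \<and> S n})" "1 \<le> N"
  shows "\<not> S N"
proof
  assume "S N"
  then have "Inf (enat ` {n. 1 \<le> n \<and> S n}) \<le> enat N" using assms(2) by (intro Inf_lower) auto
  with assms(1) show False by simp
qed

lemma norm_sq_convex_combination:
  fixes a b :: "'a::real_inner"
  assumes al: "0 \<le> \<alpha>"
  shows "(norm (\<alpha> *\<^sub>R a + b))\<^sup>2 \<le> (1 + \<alpha>) * (\<alpha> * (norm a)\<^sup>2 + (norm b)\<^sup>2)"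
proof -
  have "(1 + \<alpha>) * (\<alpha> * (norm a)\<^sup>2 + (norm b)\<^sup>2) - (norm (\<alpha> *\<^sub>R a + b))\<^sup>2 = \<alpha> * (norm (a - b))\<^sup>2"
    unfolding power2_norm_eq_inner
    by (simp add: inner_add_left inner_add_right inner_diff_left inner_diff_right
        inner_commute[of b a] power2_eq_square algebra_simps)
  moreover have "0 \<le> \<alpha> * (norm (a - b))\<^sup>2" using al by simp
  ultimately show ?thesis by linarith
qed

declare apg_seq.simps(2) [simp del]

locale apg = compact_convex_fun H for H :: "'a::euclidean_space \<Rightarrow> ereal" +
  fixes G :: "'a \<Rightarrow> real" and \<mu> L D :: real and s :: 'a
  assumes diff: "\<And>x. G differentiable at x" and strong: "quad_below \<mu> G"
    and mu: "0 < \<mu>" and muL: "\<mu> \<le> L"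
    and diam: "\<And>x y. x \<in> edom H \<Longrightarrow> y \<in> edom H \<Longrightarrow> norm (x - y) \<le> D"
    and s_dom: "s \<in> edom H" and D_pos: "0 < D"
begin

definition \<alpha> :: real where "\<alpha> = sqrt (\<mu> / L)"

definition F :: "'a \<Rightarrow> real" where "F x = G x + hr x"

abbreviation X :: "nat \<Rightarrow> 'a" where "X t \<equiv> fst (apg_seq G H \<mu> L s t)"
abbreviation U :: "nat \<Rightarrow> 'a" where "U t \<equiv> snd (apg_seq G H \<mu> L s t)"

text \<open>The auxiliary points \<open>V\<close> of the estimate-sequence argument: \<open>U\<close> is a convex
  combination of \<open>X\<close> and \<open>V\<close>.\<close>

definition V :: "nat \<Rightarrow> 'a" where
  "V t = X t + ((1 - \<alpha>) / \<alpha>) *\<^sub>R (X t - X (t - 1))"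

lemma L_pos: "0 < L" using mu muL by simp

lemma alpha: "0 < \<alpha>" "\<alpha> \<le> 1" and alpha_sq: "L * \<alpha>\<^sup>2 = \<mu>"
  using mu muL L_pos by (auto simp: \<alpha>_def)

lemma X_0: "X 0 = prox_step G H L s" and X_Suc: "X (Suc t) = prox_step G H L (U t)"
  by (simp_all add: apg_seq.simps(2) Let_def split: prod.split)

lemma X_dom: "X t \<in> edom H"
  using prox_step_in_dom L_pos by (cases t) (simp_all add: X_0 X_Suc)

lemma U_eq: "U t = (1 / (1 + \<alpha>)) *\<^sub>R (X t + \<alpha> *\<^sub>R V t)"
proof -
  have "(1 + \<alpha>) *\<^sub>R U t = X t + \<alpha> *\<^sub>R V t"
  proof (cases t)
    case 0
    then show ?thesis by (simp add: V_def scaleR_add_left)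
  next
    case (Suc n)
    have U: "U (Suc n) = X (Suc n) + ((1 - \<alpha>) / (1 + \<alpha>)) *\<^sub>R (X (Suc n) - X n)"
      by (simp add: apg_seq.simps(2) Let_def \<alpha>_def split: prod.split)
    have "(1 + \<alpha>) *\<^sub>R U (Suc n) = (1 + \<alpha>) *\<^sub>R X (Suc n) + (1 - \<alpha>) *\<^sub>R (X (Suc n) - X n)"
      unfolding U using alpha by (simp add: scaleR_add_right)
    also have "\<dots> = X (Suc n) + \<alpha> *\<^sub>R V (Suc n)"
      using alpha by (simp add: V_def scaleR_add_right scaleR_add_left)
    finally show ?thesis unfolding Suc .
  qed
  then have "(1 / (1 + \<alpha>)) *\<^sub>R ((1 + \<alpha>) *\<^sub>R U t) = (1 / (1 + \<alpha>)) *\<^sub>R (X t + \<alpha> *\<^sub>R V t)" by simp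
  then show ?thesis using alpha by simp
qed

text \<open>The basic inequality of a proximal gradient step: the model at \<open>u\<close> lies above \<open>F\<close> at
  the new point by smoothness and below it at \<open>y\<close>, up to \<open>(L - \<mu>) / 2 \<parallel>y - u\<parallel>\<^sup>2\<close>, by strong convexity, while the
  model itself is \<open>L\<close>-strongly convex with minimiser at the new point.\<close>

lemma prox_step_progress:
  assumes sm: "L_smooth_on L S G" and S: "convex S" "edom H \<subseteq> S" "u \<in> S" and y: "y \<in> edom H"
  defines "x \<equiv> prox_step G H L u"
  shows "F x \<le> F y + (L - \<mu>) / 2 * (norm (y - u))\<^sup>2 - L / 2 * (norm (y - x))\<^sup>2"
proof -
  have x: "x \<in> edom H" using prox_step_in_dom L_pos by (simp add: x_def)
  have 1: "G x \<le> G u + grad G u \<bullet> (x - u) + L/2 * (norm (x - u))\<^sup>2"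
    using L_smooth_on_upper_bound[OF sm S(1)] S x by blast
  have "- (grad G u + L *\<^sub>R (x - u)) \<in> subdiff H x"
    unfolding x_def using L_pos by (intro prox_step_subgradient) simp
  then have "hr x + (- (grad G u + L *\<^sub>R (x - u))) \<bullet> (y - x) \<le> hr y"
    using y by (auto simp: subdiff_iff)
  then have 2: "hr x \<le> hr y + grad G u \<bullet> (y - x) + L * ((x - u) \<bullet> (y - x))"
    by (simp add: inner_diff_left)
  have 3: "G u + grad G u \<bullet> (y - u) + \<mu>/2 * (norm (y - u))\<^sup>2 \<le> G y"
    using strong unfolding quad_below_def by blast
  have 4: "grad G u \<bullet> (y - u) = grad G u \<bullet> (x - u) + grad G u \<bullet> (y - x)"
    by (simp add: inner_diff_right)
  have "L/2 * (norm (y - u))\<^sup>2 = L/2 * (norm (x - u))\<^sup>2 + L * ((x - u) \<bullet> (y - x)) + L/2 * (norm (y - x))\<^sup>2"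
    unfolding norm_sq_expand[of y u x] by (simp add: algebra_simps)
  with 1 2 3 4 show ?thesis unfolding F_def by (simp add: algebra_simps diff_divide_distrib)
qed

definition x_opt :: 'a where "x_opt = (SOME x. x \<in> edom H \<and> (\<forall>y\<in>edom H. F x \<le> F y))"

lemma x_opt_dom: "x_opt \<in> edom H" and x_opt_min: "\<And>y. y \<in> edom H \<Longrightarrow> F x_opt \<le> F y"
proof -
  have "continuous_on UNIV G"
    using diff by (auto intro!: continuous_at_imp_continuous_on differentiable_imp_continuous_within)
  from minimizer_exists[OF this] have "\<exists>x. x \<in> edom H \<and> (\<forall>y\<in>edom H. F x \<le> F y)"
    unfolding F_def by blast
  from someI_ex[OF this] show "x_opt \<in> edom H" "\<And>y. y \<in> edom H \<Longrightarrow> F x_opt \<le> F y"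
    unfolding x_opt_def by auto
qed

lemma quadratic_growth:
  assumes y: "y \<in> edom H"
  shows "\<mu> / 2 * (norm (y - x_opt))\<^sup>2 \<le> F y - F x_opt"
proof -
  have "- grad G x_opt \<in> subdiff H x_opt"
    by (rule optimality_condition[OF x_opt_dom _ GDERIV_grad[OF diff]]) (use x_opt_min in \<open>simp add: F_def\<close>)
  then have "hr x_opt - grad G x_opt \<bullet> (y - x_opt) \<le> hr y" using y by (auto simp: subdiff_iff)
  moreover have "G x_opt + grad G x_opt \<bullet> (y - x_opt) + \<mu>/2 * (norm (y - x_opt))\<^sup>2 \<le> G y"
    using strong unfolding quad_below_def by blast
  ultimately show ?thesis by (simp add: F_def)
qed

definition potential :: "nat \<Rightarrow> real" where
  "potential t = F (X t) - F x_opt + \<mu> / 2 * (norm (V t - x_opt))\<^sup>2"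

lemma potential_nonneg: "0 \<le> potential t"
  using x_opt_min[OF X_dom[of t]] mu by (simp add: potential_def)

text \<open>Nesterov's contraction. The progress inequality is used at
  \<open>y = (1 - \<alpha>) X t + \<alpha> x_opt\<close>, for which the new point differs from \<open>y\<close> by
  \<open>\<alpha> (V (t + 1) - x_opt)\<close> and \<open>U t\<close> by \<open>\<alpha>\<close> times a convex combination of
  \<open>X t - x_opt\<close> and \<open>V t - x_opt\<close>; the choice of \<open>\<alpha>\<close> makes the squares match.\<close>

lemma potential_contraction:
  assumes sm: "L_smooth_on L S G" and S: "convex S" "edom H \<subseteq> S" "U t \<in> S"
  shows "potential (Suc t) \<le> (1 - \<alpha>) * potential t"
proof -
  define a where "a = X t - x_opt"
  define b where "b = V t - x_opt"
  define y where "y = (1 - \<alpha>) *\<^sub>R X t + \<alpha> *\<^sub>R x_opt"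
  have y: "y \<in> edom H"
    unfolding y_def using hr_convex_combination(1)[OF X_dom x_opt_dom] alpha by simp
  have 1: "F (X (Suc t)) \<le> F y + (L - \<mu>) / 2 * (norm (y - U t))\<^sup>2 - L / 2 * (norm (y - X (Suc t)))\<^sup>2"
    unfolding X_Suc by (rule prox_step_progress[OF sm S y])
  have "G y \<le> (1 - \<alpha>) * G (X t) + \<alpha> * G x_opt - \<mu>/2 * (\<alpha> * (1 - \<alpha>)) * (norm a)\<^sup>2"
    unfolding y_def a_def using alpha by (intro quad_below_combination strong) auto
  moreover have "hr y \<le> (1 - \<alpha>) * hr (X t) + \<alpha> * hr x_opt"
    unfolding y_def using alpha by (intro hr_convex_combination(2) X_dom x_opt_dom) auto
  ultimately have 2: "F y \<le> (1 - \<alpha>) * F (X t) + \<alpha> * F x_opt - \<mu>/2 * (\<alpha> * (1 - \<alpha>)) * (norm a)\<^sup>2"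
    by (simp add: F_def algebra_simps)
  have "y - X (Suc t) = - (\<alpha> *\<^sub>R (V (Suc t) - x_opt))"
    using alpha by (simp add: y_def V_def scaleR_add_right scaleR_diff_right scaleR_diff_left)
  then have 3: "L / 2 * (norm (y - X (Suc t)))\<^sup>2 = \<mu> / 2 * (norm (V (Suc t) - x_opt))\<^sup>2"
    using alpha_sq by (simp add: power_mult_distrib)
  have "(1 + \<alpha>) *\<^sub>R (U t - y) = \<alpha> *\<^sub>R (\<alpha> *\<^sub>R a + b)"
  proof -
    have "(1 + \<alpha>) *\<^sub>R U t = X t + \<alpha> *\<^sub>R V t" using alpha by (subst U_eq) simp
    then have "(1 + \<alpha>) *\<^sub>R (U t - y) = X t + \<alpha> *\<^sub>R V t - (1 + \<alpha>) *\<^sub>R y"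
      by (simp only: scaleR_diff_right)
    then show ?thesis by (simp add: a_def b_def y_def algebra_simps)
  qed
  then have "norm ((1 + \<alpha>) *\<^sub>R (U t - y)) = norm (\<alpha> *\<^sub>R (\<alpha> *\<^sub>R a + b))" by simp
  then have "(1 + \<alpha>) * norm (y - U t) = \<alpha> * norm (\<alpha> *\<^sub>R a + b)"
    using alpha by (simp add: norm_minus_commute)
  then have "(1 + \<alpha>)\<^sup>2 * (norm (y - U t))\<^sup>2 = \<alpha>\<^sup>2 * (norm (\<alpha> *\<^sub>R a + b))\<^sup>2"
    unfolding power_mult_distrib[symmetric] by (rule arg_cong)
  also have "\<dots> \<le> \<alpha>\<^sup>2 * ((1 + \<alpha>) * (\<alpha> * (norm a)\<^sup>2 + (norm b)\<^sup>2))"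
    using alpha by (intro mult_left_mono norm_sq_convex_combination) auto
  finally have "(1 + \<alpha>) * ((1 + \<alpha>) * (norm (y - U t))\<^sup>2) \<le> (1 + \<alpha>) * (\<alpha>\<^sup>2 * (\<alpha> * (norm a)\<^sup>2 + (norm b)\<^sup>2))"
    by (simp only: power2_eq_square mult.assoc mult.left_commute)
  then have "(1 + \<alpha>) * (norm (y - U t))\<^sup>2 \<le> \<alpha>\<^sup>2 * (\<alpha> * (norm a)\<^sup>2 + (norm b)\<^sup>2)"
    using alpha by (subst (asm) mult_le_cancel_left_pos) auto
  then have "L/2 * (1 - \<alpha>) * ((1 + \<alpha>) * (norm (y - U t))\<^sup>2)
      \<le> L/2 * (1 - \<alpha>) * (\<alpha>\<^sup>2 * (\<alpha> * (norm a)\<^sup>2 + (norm b)\<^sup>2))"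
    using alpha L_pos by (intro mult_left_mono) auto
  moreover have "L/2 * (1 - \<alpha>) * ((1 + \<alpha>) * n) = (L - \<mu>) / 2 * n" for n
  proof -
    have "L/2 * (1 - a) * ((1 + a) * n) = (L - L * a\<^sup>2) / 2 * n" for a
      by (simp add: field_simps power2_eq_square)
    from this[of \<alpha>] show ?thesis unfolding alpha_sq .
  qed
  moreover have "L/2 * (1 - \<alpha>) * (\<alpha>\<^sup>2 * (\<alpha> * m + n))
      = \<mu>/2 * (\<alpha> * (1 - \<alpha>)) * m + (1 - \<alpha>) * (\<mu>/2 * n)" for m n
  proof -
    have "L/2 * (1 - a) * (a\<^sup>2 * (a * m + n)) = (L * a\<^sup>2)/2 * (a * (1 - a)) * m + (1 - a) * ((L * a\<^sup>2)/2 * n)" for a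
      by (simp add: field_simps power2_eq_square)
    from this[of \<alpha>] show ?thesis unfolding alpha_sq .
  qed
  ultimately have 4: "(L - \<mu>) / 2 * (norm (y - U t))\<^sup>2
      \<le> \<mu>/2 * (\<alpha> * (1 - \<alpha>)) * (norm a)\<^sup>2 + (1 - \<alpha>) * (\<mu>/2 * (norm b)\<^sup>2)" by metis
  have "F (X (Suc t)) + \<mu>/2 * (norm (V (Suc t) - x_opt))\<^sup>2 - F x_opt
      \<le> (1 - \<alpha>) * F (X t) + \<alpha> * F x_opt + (1 - \<alpha>) * (\<mu>/2 * (norm b)\<^sup>2) - F x_opt"
    using 1 2 3 4 by linarith
  then show ?thesis unfolding potential_def b_def by (simp add: algebra_simps)
qed

text \<open>The starting proximal step is itself a progress step from \<open>s\<close>. This bounds the initial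
  potential through \<open>L\<close> and the diameter, without a bound on the values of \<open>H\<close>.\<close>

lemma potential_bound:
  assumes sm: "L_smooth_on L S G" and S: "convex S" "edom H \<subseteq> S" "\<And>i. i < t \<Longrightarrow> U i \<in> S"
  shows "potential t \<le> L / 2 * D\<^sup>2 * exp (- \<alpha> * t)"
  using S(3)
proof (induction t)
  case 0
  have "F (X 0) \<le> F x_opt + (L - \<mu>) / 2 * (norm (x_opt - s))\<^sup>2 - L / 2 * (norm (x_opt - X 0))\<^sup>2"
    unfolding X_0 using S s_dom by (intro prox_step_progress[OF sm _ _ _ x_opt_dom]) auto
  then have "potential 0 \<le> (L - \<mu>) / 2 * (norm (x_opt - s))\<^sup>2 - (L - \<mu>) / 2 * (norm (x_opt - X 0))\<^sup>2"
    by (simp add: potential_def V_def norm_minus_commute algebra_simps diff_divide_distrib)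
  also have "\<dots> \<le> (L - \<mu>) / 2 * (norm (x_opt - s))\<^sup>2" using muL by simp
  also have "\<dots> \<le> L / 2 * D\<^sup>2"
    using muL mu diam[OF x_opt_dom s_dom] by (intro mult_mono power_mono) auto
  finally show ?case by simp
next
  case (Suc t)
  have "potential (Suc t) \<le> (1 - \<alpha>) * potential t" by (rule potential_contraction[OF sm S(1,2)]) (use Suc.prems in simp)
  also have "\<dots> \<le> exp (- \<alpha>) * potential t" using potential_nonneg exp_ge_add_one_self[of "- \<alpha>"] by (intro mult_right_mono) auto
  also have "\<dots> \<le> exp (- \<alpha>) * (L / 2 * D\<^sup>2 * exp (- \<alpha> * t))"
    using Suc by (intro mult_left_mono) auto
  also have "\<dots> = L / 2 * D\<^sup>2 * exp (- \<alpha> * Suc t)" by (simp add: algebra_simps flip: exp_add)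
  finally show ?case .
qed

text \<open>The optimality condition of the proximal step provides a subgradient whose residual is at
  most \<open>2 L \<parallel>X (t + 1) - U t\<parallel>\<close>, and both points are close to the minimiser.\<close>

lemma stationarity_decay:
  assumes sm: "L_smooth_on L S G" and S: "convex S" "edom H \<subseteq> S" "\<And>i. i \<le> t \<Longrightarrow> U i \<in> S"
  shows "dist_set (- grad G (X (Suc t))) (subdiff H (X (Suc t)))
    \<le> ereal (4 * L * D / \<alpha> * exp (- \<alpha> * t / 2))"
proof -
  define x where "x = X (Suc t)"
  define r where "r = D / \<alpha> * exp (- \<alpha> * t / 2)"
  have r0: "0 \<le> r" using alpha D_pos by (simp add: r_def)
  have r2: "r\<^sup>2 = 2 / \<mu> * (L / 2 * D\<^sup>2 * exp (- \<alpha> * t))"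
  proof -
    have "(exp (- \<alpha> * t / 2))\<^sup>2 = exp (- \<alpha> * t)" by (simp add: power2_eq_square flip: exp_add)
    then have "r\<^sup>2 = D\<^sup>2 * (1 / \<alpha>\<^sup>2) * exp (- \<alpha> * t)" unfolding r_def by (simp add: power_mult_distrib power_divide)
    moreover have "1 / \<alpha>\<^sup>2 = L / \<mu>" 
      using alpha alpha_sq mu by (subst frac_eq_eq) auto
    ultimately show ?thesis by simp
  qed
  have potential: "potential t \<le> L / 2 * D\<^sup>2 * exp (- \<alpha> * t)" using potential_bound[OF sm S(1,2)] S(3) by auto
  have "potential (Suc t) \<le> (1 - \<alpha>) * potential t" using potential_contraction[OF sm S(1,2) S(3)] by simp
  also have "\<dots> \<le> potential t" using alpha potential_nonneg[of t] by (simp add: algebra_simps)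
  finally have potential': "potential (Suc t) \<le> L / 2 * D\<^sup>2 * exp (- \<alpha> * t)" using potential by simp
  have close: "norm z \<le> r" if "\<mu> / 2 * (norm z)\<^sup>2 \<le> L / 2 * D\<^sup>2 * exp (- \<alpha> * t)" for z :: 'a
  proof (rule power2_le_imp_le[OF _ r0])
    have "2 / \<mu> * (\<mu> / 2 * (norm z)\<^sup>2) \<le> 2 / \<mu> * (L / 2 * D\<^sup>2 * exp (- \<alpha> * t))"
      using that mu by (intro mult_left_mono) auto
    then show "(norm z)\<^sup>2 \<le> r\<^sup>2" using mu unfolding r2 by simp
  qed
  have Xt: "norm (X t - x_opt) \<le> r"
  proof (rule close)
    have "0 \<le> \<mu> / 2 * (norm (V t - x_opt))\<^sup>2" using mu by simp
    then show "\<mu> / 2 * (norm (X t - x_opt))\<^sup>2 \<le> L / 2 * D\<^sup>2 * exp (- \<alpha> * t)"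
      using quadratic_growth[OF X_dom[of t]] potential unfolding potential_def by linarith
  qed
  have x: "norm (x - x_opt) \<le> r"
  proof (rule close)
    have "0 \<le> \<mu> / 2 * (norm (V (Suc t) - x_opt))\<^sup>2" using mu by simp
    then show "\<mu> / 2 * (norm (x - x_opt))\<^sup>2 \<le> L / 2 * D\<^sup>2 * exp (- \<alpha> * t)"
      using quadratic_growth[OF X_dom[of "Suc t"]] potential' unfolding potential_def x_def by linarith
  qed
  have Vt: "norm (V t - x_opt) \<le> r"
    by (rule close) (use potential x_opt_min[OF X_dom[of t]] in \<open>simp add: potential_def\<close>)
  have "norm (U t - x_opt) \<le> r"
  proof -
    have "U t - x_opt = (1 / (1 + \<alpha>)) *\<^sub>R ((X t - x_opt) + \<alpha> *\<^sub>R (V t - x_opt))"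
    proof -
      have "x_opt + \<alpha> *\<^sub>R x_opt = (1 + \<alpha>) *\<^sub>R x_opt" by (simp add: scaleR_add_left)
      then have "x_opt = (1 / (1 + \<alpha>)) *\<^sub>R (x_opt + \<alpha> *\<^sub>R x_opt)" using alpha by simp
      then have "U t - x_opt = (1 / (1 + \<alpha>)) *\<^sub>R (X t + \<alpha> *\<^sub>R V t) - (1 / (1 + \<alpha>)) *\<^sub>R (x_opt + \<alpha> *\<^sub>R x_opt)"
        unfolding U_eq by simp
      then show ?thesis by (simp add: algebra_simps)
    qed
    then have "norm (U t - x_opt) = 1 / (1 + \<alpha>) * norm ((X t - x_opt) + \<alpha> *\<^sub>R (V t - x_opt))"
      using alpha by simp
    also have "\<dots> \<le> 1 / (1 + \<alpha>) * (r + \<alpha> * r)"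
      using alpha Xt Vt by (intro mult_left_mono norm_triangle_le add_mono) auto
    also have "\<dots> = r" using alpha by (simp add: field_simps)
    finally show ?thesis .
  qed
  then have xU: "norm (x - U t) \<le> 2 * r"
    using x norm_triangle_ineq4[of "x - x_opt" "U t - x_opt"] by simp
  define w where "w = - (grad G (U t) + L *\<^sub>R (x - U t))"
  have w: "w \<in> subdiff H x"
    unfolding w_def x_def X_Suc using L_pos by (intro prox_step_subgradient) simp
  have "norm (- grad G x - w) \<le> norm (grad G (U t) - grad G x) + norm (L *\<^sub>R (x - U t))"
    unfolding w_def using norm_triangle_ineq[of "grad G (U t) - grad G x" "L *\<^sub>R (x - U t)"]
    by (simp add: algebra_simps)
  also have "norm (grad G (U t) - grad G x) \<le> L * norm (U t - x)"
    using sm S X_dom[of "Suc t"] unfolding L_smooth_on_def x_def by blast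
  finally have "norm (- grad G x - w) \<le> 2 * L * norm (x - U t)"
    using L_pos by (simp add: norm_minus_commute)
  also have "\<dots> \<le> 2 * L * (2 * r)" using xU L_pos by (intro mult_left_mono) auto
  finally have le: "norm (- grad G x - w) \<le> 4 * L * r" by simp
  have "dist_set (- grad G x) (subdiff H x) \<le> ereal (norm (- grad G x - w))"
    unfolding dist_set_def by (rule INF_lower[OF w])
  also have "\<dots> \<le> ereal (4 * L * r)" using le by simp
  finally show ?thesis unfolding x_def r_def by (simp add: mult.assoc)
qed

text \<open>The residual after \<open>t\<close> iterations is at most a constant times \<open>exp (- \<alpha> t / 2)\<close>, so the test
  succeeds as soon as this drops below \<open>\<epsilon>\<close>. Up to then all
  points visited are covered by the smoothness requirement.\<close>

lemma apg_terminates: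
  assumes inp: "apg_smooth_input G H \<mu> L \<epsilon> s" and eps: "0 < \<epsilon>"
  obtains N where "apg_count G H \<mu> L \<epsilon> s = enat N"
    "real N \<le> 2 + 2 / \<alpha> * max 0 (ln (4 * L * D / (\<alpha> * \<epsilon>)))"
    "apg_out G H \<mu> L \<epsilon> s \<in> edom H"
    "dist_set (- grad G (apg_out G H \<mu> L \<epsilon> s)) (subdiff H (apg_out G H \<mu> L \<epsilon> s)) \<le> ereal \<epsilon>"
proof -
  define ok where "ok N \<longleftrightarrow> dist_set (- grad G (X N)) (subdiff H (X N)) \<le> ereal \<epsilon>" for N
  have count: "apg_count G H \<mu> L \<epsilon> s = Inf (enat ` {N. 1 \<le> N \<and> ok N})"
    by (simp add: apg_count_def ok_def Let_def)
  define S where "S = convex hull (edom H \<union> {U t |t. enat t < apg_count G H \<mu> L \<epsilon> s})"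
  have sm: "L_smooth_on L S G" using inp by (simp add: apg_smooth_input_def S_def)
  have S: "convex S" "edom H \<subseteq> S"
    unfolding S_def by (auto intro: hull_inc)
  have SU: "U t \<in> S" if "enat t < apg_count G H \<mu> L \<epsilon> s" for t
    unfolding S_def by (rule hull_inc) (use that in blast)
  define b where "b = 2 / \<alpha> * max 0 (ln (4 * L * D / (\<alpha> * \<epsilon>)))"
  have b0: "0 \<le> b" using alpha by (simp add: b_def)
  have "real N \<le> 1 + b" if N: "enat N < apg_count G H \<mu> L \<epsilon> s" for N
  proof (cases N)
    case 0
    then show ?thesis using b0 by simp
  next
    case (Suc t)
    have "\<not> ok (Suc t)"
      by (rule not_success_before_first[where N = "Suc t"]) (use N count Suc in auto)
    moreover have "dist_set (- grad G (X (Suc t))) (subdiff H (X (Suc t)))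
        \<le> ereal (4 * L * D / \<alpha> * exp (- \<alpha> * t / 2))"
    proof (rule stationarity_decay[OF sm S])
      fix i assume "i \<le> t"
      then show "U i \<in> S"
        using N Suc by (intro SU order_le_less_trans[OF _ N]) simp
    qed
    ultimately have "\<not> ereal (4 * L * D / \<alpha> * exp (- \<alpha> * t / 2)) \<le> ereal \<epsilon>"
      unfolding ok_def using order_trans by blast
    then have "\<epsilon> < 4 * L * D / \<alpha> * exp (- (\<alpha> * t / 2))" by simp
    then have "\<epsilon> < 4 * L * D / \<alpha> / exp (\<alpha> * t / 2)"
      unfolding exp_minus divide_inverse .
    then have "\<epsilon> * exp (\<alpha> * t / 2) < 4 * L * D / \<alpha>"
      by (subst (asm) pos_less_divide_eq) simp_all
    then have "exp (\<alpha> * t / 2) < 4 * L * D / \<alpha> / \<epsilon>"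
      using eps by (subst pos_less_divide_eq) (simp_all only: mult.commute)
    then have "exp (\<alpha> * t / 2) < 4 * L * D / (\<alpha> * \<epsilon>)"
      unfolding divide_divide_eq_left .
    moreover have "0 < 4 * L * D / (\<alpha> * \<epsilon>)" using L_pos D_pos alpha eps by simp
    ultimately have "\<alpha> * t / 2 < ln (4 * L * D / (\<alpha> * \<epsilon>))"
      by (subst exp_less_cancel_iff[symmetric]) simp
    then have "\<alpha> * t / 2 \<le> max 0 (ln (4 * L * D / (\<alpha> * \<epsilon>)))" by simp
    then have "2 / \<alpha> * (\<alpha> * t / 2) \<le> b" unfolding b_def using alpha by (intro mult_left_mono) auto
    then show ?thesis using alpha Suc by simp
  qed
  then obtain N where N: "apg_count G H \<mu> L \<epsilon> s = enat N" "ok N" "real N \<le> 1 + b + 1"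
    unfolding count by (rule first_success_bounded)
  then have "apg_out G H \<mu> L \<epsilon> s = X N" by (simp add: apg_out_def)
  with N X_dom that show ?thesis by (simp add: ok_def b_def)
qed

end

section \<open>Inexact proximal point method\<close>

text \<open>The linear rate \<open>1 - sqrt (\<mu> / L)\<close> turned into a number of iterations; \<open>D\<close> is the
  diameter of the domain.\<close>

definition apg_bound :: "real \<Rightarrow> real \<Rightarrow> real \<Rightarrow> real \<Rightarrow> real" where
  "apg_bound \<mu> L D \<epsilon> = 2 + 2 / sqrt (\<mu> / L) * max 0 (ln (4 * L * D / (sqrt (\<mu> / L) * \<epsilon>)))"

lemma sum_enat_bounded:
  fixes c :: "nat \<Rightarrow> enat"
  assumes "\<And>j. j < J \<Longrightarrow> \<exists>n. c j = enat n \<and> real n \<le> b"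
  shows "\<exists>N. (\<Sum>j<J. c j) = enat N \<and> real N \<le> real J * b"
  using assms
proof (induction J)
  case 0
  then show ?case by (auto simp: zero_enat_def)
next
  case (Suc J)
  from Suc.IH Suc.prems obtain N where N: "(\<Sum>j<J. c j) = enat N" "real N \<le> real J * b"
    by (meson less_SucI)
  obtain n where n: "c J = enat n" "real n \<le> b" using Suc.prems by blast
  have "(\<Sum>j<Suc J. c j) = enat (N + n)" using N n by simp
  moreover have "real (N + n) \<le> real (Suc J) * b" using N n by (simp add: algebra_simps)
  ultimately show ?case by blast
qed

lemma dist_set_less:
  assumes "dist_set x X \<le> ereal a" "a < b"
  obtains w where "w \<in> X" "norm (x - w) < b"
proof -
  have "dist_set x X < ereal b" using assms by (simp add: order_le_less_trans)
  then show ?thesis using that unfolding dist_set_def INF_less_iff by auto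
qed

context compact_convex_fun
begin

text \<open>The infimum in the distance need not be attained a priori, hence the limit argument.\<close>

lemma near_stationary_value:
  assumes qb: "quad_below \<mu> G" and st: "dist_set (- grad G x) (subdiff H x) \<le> ereal \<delta>"
    and y: "y \<in> edom H"
  shows "G x + hr x + \<mu> / 2 * (norm (y - x))\<^sup>2 - \<delta> * norm (y - x) \<le> G y + hr y"
proof (rule field_le_epsilon)
  fix e :: real assume e: "0 < e"
  define \<eta> where "\<eta> = e / (norm (y - x) + 1)"
  have n1: "0 < norm (y - x) + 1" by (simp add: add_nonneg_pos)
  have eta: "0 < \<eta>" using e n1 by (simp add: \<eta>_def)
  have "\<eta> * norm (y - x) \<le> \<eta> * (norm (y - x) + 1)" using eta by (intro mult_left_mono) auto
  also have "\<dots> = e" using n1 by (simp add: \<eta>_def)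
  finally have eta_e: "\<eta> * norm (y - x) \<le> e" .
  obtain w where w: "w \<in> subdiff H x" "norm (- grad G x - w) < \<delta> + \<eta>"
    using dist_set_less[OF st, of "\<delta> + \<eta>"] eta by auto
  have 1: "hr x + w \<bullet> (y - x) \<le> hr y" using w(1) y by (simp add: subdiff_iff)
  have 2: "G x + grad G x \<bullet> (y - x) + \<mu> / 2 * (norm (y - x))\<^sup>2 \<le> G y"
    using qb unfolding quad_below_def by blast
  have "(- grad G x - w) \<bullet> (y - x) \<le> norm (- grad G x - w) * norm (y - x)"
    by (rule norm_cauchy_schwarz)
  also have "\<dots> \<le> (\<delta> + \<eta>) * norm (y - x)" using w(2) by (intro mult_right_mono) auto
  finally have "- (grad G x \<bullet> (y - x)) - w \<bullet> (y - x) \<le> \<delta> * norm (y - x) + e"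
    using eta_e by (simp add: inner_diff_left distrib_right)
  with 1 2 show "G x + hr x + \<mu> / 2 * (norm (y - x))\<^sup>2 - \<delta> * norm (y - x) \<le> G y + hr y + e"
    by linarith
qed

end

locale ippm = compact_convex_fun H for H :: "'a::euclidean_space \<Rightarrow> ereal" +
  fixes \<phi> :: "'a \<Rightarrow> real" and \<rho> L D \<epsilon> \<Delta> :: real and x0 :: 'a and s :: "nat \<Rightarrow> 'a"
  assumes diff: "\<And>x. \<phi> differentiable at x" and weak: "quad_below (- \<rho>) \<phi>"
    and rho: "0 < \<rho>" and L_nonneg: "0 \<le> L" and eps: "0 < \<epsilon>" and D_pos: "0 < D"
    and diam: "\<And>x y. x \<in> edom H \<Longrightarrow> y \<in> edom H \<Longrightarrow> norm (x - y) \<le> D"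
    and x0_dom: "x0 \<in> edom H" and s_dom: "\<And>j. s j \<in> edom H"
    and inputs: "ippm_smooth_inputs \<phi> H x0 \<rho> L \<epsilon> s"
    and gap: "\<And>x. x \<in> edom H \<Longrightarrow> \<phi> x0 + hr x0 \<le> \<phi> x + hr x + \<Delta>"
begin

abbreviation X :: "nat \<Rightarrow> 'a" where "X \<equiv> ippm_seq \<phi> H x0 \<rho> L \<epsilon> s"
abbreviation calls :: enat where "calls \<equiv> ippm_calls \<phi> H x0 \<rho> L \<epsilon> s"
abbreviation G :: "nat \<Rightarrow> 'a \<Rightarrow> real" where "G j \<equiv> ippm_G \<phi> \<rho> (X j)"

lemma G_strong: "quad_below \<rho> (G j)"
  using quad_below_add_norm_sq[OF weak diff, of \<rho> "X j"] by (simp add: ippm_G_def[abs_def])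

lemma GDERIV_G: "GDERIV (G j) x :> grad \<phi> x + (2 * \<rho>) *\<^sub>R (x - X j)"
  unfolding ippm_G_def[abs_def] by (intro GDERIV_add GDERIV_grad diff GDERIV_norm_sq)

lemma grad_G: "grad (G j) x = grad \<phi> x + (2 * \<rho>) *\<^sub>R (x - X j)"
  by (rule grad_eqI[OF GDERIV_G])

lemma G_diff: "G j differentiable at x"
  using GDERIV_G unfolding gderiv_def differentiable_def by blast

text \<open>Induction over the calls, because the input requirement of a call is only granted once all
  earlier calls have terminated.\<close>

lemma apg_call:
  assumes "enat j < calls"
  shows "(\<exists>n. ippm_apg_count \<phi> H x0 \<rho> L \<epsilon> s j = enat n \<and> real n \<le> apg_bound \<rho> (L + 2 * \<rho>) D (\<epsilon> / 4))
    \<and> X (Suc j) \<in> edom H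
    \<and> dist_set (- grad (G j) (X (Suc j))) (subdiff H (X (Suc j))) \<le> ereal (\<epsilon> / 4)"
  using assms
proof (induction j rule: less_induct)
  case (less j)
  have fin: "ippm_apg_count \<phi> H x0 \<rho> L \<epsilon> s i \<noteq> \<infinity>" if "i < j" for i
  proof -
    have "enat i < enat j" using that by simp
    then have "enat i < calls" using less.prems by (rule less_trans)
    from less.IH[OF that this] show ?thesis by auto
  qed
  interpret A: apg H "G j" \<rho> "L + 2 * \<rho>" D "s j"
    by unfold_locales (use G_diff G_strong rho L_nonneg diam s_dom D_pos in auto)
  have "apg_smooth_input (G j) H \<rho> (L + 2 * \<rho>) (\<epsilon> / 4) (s j)"
    using inputs less.prems fin unfolding ippm_smooth_inputs_def by blast
  moreover have "0 < \<epsilon> / 4" using eps by simp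
  ultimately obtain N where N: "apg_count (G j) H \<rho> (L + 2 * \<rho>) (\<epsilon> / 4) (s j) = enat N"
    "real N \<le> 2 + 2 / A.\<alpha> * max 0 (ln (4 * (L + 2 * \<rho>) * D / (A.\<alpha> * (\<epsilon> / 4))))"
    "X (Suc j) \<in> edom H"
    "dist_set (- grad (G j) (X (Suc j))) (subdiff H (X (Suc j))) \<le> ereal (\<epsilon> / 4)"
    unfolding ippm_seq.simps by (rule A.apg_terminates)
  then show ?case unfolding ippm_apg_count_def apg_bound_def A.\<alpha>_def by blast
qed

lemma X_dom: "enat j \<le> calls \<Longrightarrow> X j \<in> edom H"
proof (cases j)
  case (Suc i)
  assume "enat j \<le> calls"
  then have "enat i < calls" using Suc Suc_ile_eq by simp
  then show ?thesis using apg_call Suc by blast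
qed (use x0_dom in simp)

lemma calls_eq: "calls = Inf (enat ` {J. 1 \<le> J \<and> 2 * \<rho> * norm (X J - X (J - 1)) \<le> \<epsilon> / 2})"
  by (simp add: ippm_calls_def)

text \<open>A step that fails the stopping test is long, and then the quadratic gain outweighs the
  error allowed in the subproblem.\<close>

lemma sufficient_decrease:
  assumes j: "enat (Suc j) < calls"
  shows "\<phi> (X (Suc j)) + hr (X (Suc j)) + \<epsilon>\<^sup>2 / (32 * \<rho>) \<le> \<phi> (X j) + hr (X j)"
proof -
  define d where "d = norm (X j - X (Suc j))"
  have "\<not> 2 * \<rho> * norm (X (Suc j) - X (Suc j - 1)) \<le> \<epsilon> / 2"
    using j by (intro not_success_before_first[of "Suc j" "\<lambda>J. 2 * \<rho> * norm (X J - X (J - 1)) \<le> \<epsilon> / 2"])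
      (simp_all only: calls_eq)
  then have d: "\<epsilon> / 4 < \<rho> * d" by (simp add: d_def norm_minus_commute)
  have j': "enat j < calls" by (rule less_trans[OF _ j]) simp
  have "G j (X (Suc j)) + hr (X (Suc j)) + \<rho> / 2 * (norm (X j - X (Suc j)))\<^sup>2 - \<epsilon> / 4 * norm (X j - X (Suc j))
      \<le> G j (X j) + hr (X j)"
    using apg_call[OF j'] X_dom[of j] j' by (intro near_stationary_value G_strong) auto
  then have 1: "\<phi> (X (Suc j)) + hr (X (Suc j)) + (3 / 2 * (\<rho> * d\<^sup>2) - \<epsilon> / 4 * d) \<le> \<phi> (X j) + hr (X j)"
    unfolding ippm_G_def d_def[symmetric] norm_minus_commute[of "X (Suc j)" "X j"] by simp
  have d0: "0 \<le> d" by (simp add: d_def)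
  have "\<epsilon> / 4 * d \<le> \<rho> * d * d" using d d0 by (intro mult_right_mono) auto
  then have 2: "\<epsilon> / 4 * d \<le> \<rho> * d\<^sup>2" by (simp add: power2_eq_square)
  have "(\<epsilon> / 4)\<^sup>2 \<le> (\<rho> * d)\<^sup>2" using d eps by (intro power_mono) auto
  then have "\<epsilon>\<^sup>2 / 16 \<le> \<rho> * (\<rho> * d\<^sup>2)" by (simp add: power2_eq_square mult_ac)
  then have 3: "\<epsilon>\<^sup>2 / (32 * \<rho>) \<le> 1 / 2 * (\<rho> * d\<^sup>2)" using rho by (simp add: field_simps)
  from 1 2 3 show ?thesis by linarith
qed

lemma calls_bound:
  assumes "enat N < calls"
  shows "real N \<le> 32 * \<rho> * \<Delta> / \<epsilon>\<^sup>2"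
proof -
  have "\<phi> (X N) + hr (X N) + real N * (\<epsilon>\<^sup>2 / (32 * \<rho>)) \<le> \<phi> x0 + hr x0"
    using assms
  proof (induction N)
    case (Suc N)
    have "enat N < calls" by (rule less_trans[OF _ Suc.prems]) simp
    then have "\<phi> (X N) + hr (X N) + real N * (\<epsilon>\<^sup>2 / (32 * \<rho>)) \<le> \<phi> x0 + hr x0" by (rule Suc.IH)
    moreover have "real (Suc N) * (\<epsilon>\<^sup>2 / (32 * \<rho>)) = real N * (\<epsilon>\<^sup>2 / (32 * \<rho>)) + \<epsilon>\<^sup>2 / (32 * \<rho>)"
      by (simp add: distrib_right add_divide_distrib)
    ultimately show ?case using sufficient_decrease[OF Suc.prems] by linarith
  qed simp
  with gap[OF X_dom[OF less_imp_le[OF assms]]] have "real N * (\<epsilon>\<^sup>2 / (32 * \<rho>)) \<le> \<Delta>" by linarith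
  then show ?thesis using rho eps by (simp add: field_simps)
qed

text \<open>At the output, the residual \<open>\<epsilon> / 4\<close> of the subproblem and the gradient of the proximal term,
  of norm at most \<open>\<epsilon> / 2\<close> by the stopping test, add up to less than \<open>\<epsilon>\<close>. The remaining slack
  makes up for a distance that need not be attained.\<close>

lemma ippm_terminates:
  obtains N where "ippm_cost \<phi> H x0 \<rho> L \<epsilon> s = enat N"
    "real N \<le> (1 + 32 * \<rho> * \<Delta> / \<epsilon>\<^sup>2) * apg_bound \<rho> (L + 2 * \<rho>) D (\<epsilon> / 4)"
    "ippm_out \<phi> H x0 \<rho> L \<epsilon> s \<in> edom H"
    "\<exists>w\<in>subdiff H (ippm_out \<phi> H x0 \<rho> L \<epsilon> s). norm (grad \<phi> (ippm_out \<phi> H x0 \<rho> L \<epsilon> s) + w) < \<epsilon>"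
proof -
  have "real N \<le> 32 * \<rho> * \<Delta> / \<epsilon>\<^sup>2"
    if "enat N < Inf (enat ` {J. 1 \<le> J \<and> 2 * \<rho> * norm (X J - X (J - 1)) \<le> \<epsilon> / 2})" for N
    using calls_bound that unfolding calls_eq .
  then obtain J where J: "calls = enat J" "1 \<le> J" "2 * \<rho> * norm (X J - X (J - 1)) \<le> \<epsilon> / 2"
    "real J \<le> 32 * \<rho> * \<Delta> / \<epsilon>\<^sup>2 + 1"
    unfolding calls_eq by (rule first_success_bounded)
  define x where "x = X J"
  have out: "ippm_out \<phi> H x0 \<rho> L \<epsilon> s = x" by (simp add: ippm_out_def J x_def)
  have "\<exists>N. (\<Sum>j<J. ippm_apg_count \<phi> H x0 \<rho> L \<epsilon> s j) = enat N
    \<and> real N \<le> real J * apg_bound \<rho> (L + 2 * \<rho>) D (\<epsilon> / 4)"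
  proof (rule sum_enat_bounded)
    fix j assume "j < J"
    then have "enat j < calls" using J(1) by simp
    then show "\<exists>n. ippm_apg_count \<phi> H x0 \<rho> L \<epsilon> s j = enat n \<and> real n \<le> apg_bound \<rho> (L + 2 * \<rho>) D (\<epsilon> / 4)"
      using apg_call by simp
  qed
  then obtain N where N: "(\<Sum>j<J. ippm_apg_count \<phi> H x0 \<rho> L \<epsilon> s j) = enat N"
    "real N \<le> real J * apg_bound \<rho> (L + 2 * \<rho>) D (\<epsilon> / 4)" by (elim exE conjE)
  have cost: "ippm_cost \<phi> H x0 \<rho> L \<epsilon> s = enat N" by (simp add: ippm_cost_def J N)
  have b: "0 \<le> apg_bound \<rho> (L + 2 * \<rho>) D (\<epsilon> / 4)"
    unfolding apg_bound_def using rho L_nonneg by (intro add_nonneg_nonneg mult_nonneg_nonneg) auto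
  have "real J * apg_bound \<rho> (L + 2 * \<rho>) D (\<epsilon> / 4)
      \<le> (1 + 32 * \<rho> * \<Delta> / \<epsilon>\<^sup>2) * apg_bound \<rho> (L + 2 * \<rho>) D (\<epsilon> / 4)"
    using J(4) by (intro mult_right_mono b) simp
  then have bound: "real N \<le> (1 + 32 * \<rho> * \<Delta> / \<epsilon>\<^sup>2) * apg_bound \<rho> (L + 2 * \<rho>) D (\<epsilon> / 4)"
    using N(2) by linarith
  have J1: "Suc (J - 1) = J" using J(2) by simp
  have lt: "enat (J - 1) < calls" using J by simp
  have dom: "x \<in> edom H" and st: "dist_set (- grad (G (J - 1)) x) (subdiff H x) \<le> ereal (\<epsilon> / 4)"
    using apg_call[OF lt] unfolding J1 x_def by auto
  obtain w where w: "w \<in> subdiff H x" "norm (- grad (G (J - 1)) x - w) < \<epsilon> / 2"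
    using dist_set_less[OF st, of "\<epsilon> / 2"] eps by auto
  have "grad \<phi> x + w = - (- grad (G (J - 1)) x - w) - (2 * \<rho>) *\<^sub>R (x - X (J - 1))"
    unfolding grad_G by simp
  then have "norm (grad \<phi> x + w)
      = norm (- (- grad (G (J - 1)) x - w) - (2 * \<rho>) *\<^sub>R (x - X (J - 1)))" by (rule arg_cong)
  also have "\<dots> \<le> norm (- (- grad (G (J - 1)) x - w)) + norm ((2 * \<rho>) *\<^sub>R (x - X (J - 1)))"
    by (rule norm_triangle_ineq4)
  also have "norm (- (- grad (G (J - 1)) x - w)) = norm (- grad (G (J - 1)) x - w)"
    by (rule norm_minus_cancel)
  also have "norm (- grad (G (J - 1)) x - w) + norm ((2 * \<rho>) *\<^sub>R (x - X (J - 1))) < \<epsilon> / 2 + \<epsilon> / 2"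
    using w(2) J(3) rho by (intro add_less_le_mono) (simp_all add: x_def)
  finally have "norm (grad \<phi> x + w) < \<epsilon>" by simp
  with w(1) have "\<exists>w\<in>subdiff H x. norm (grad \<phi> x + w) < \<epsilon>" by (rule rev_bexI)
  with cost bound dom that show thesis unfolding out by simp
qed

end

section \<open>The augmented Lagrangian\<close>

lemma norm_pos_part_sq: "(norm (pos_part a))\<^sup>2 = (\<Sum>j\<in>UNIV. (max 0 (a $ j))\<^sup>2)"
  unfolding power2_norm_eq_inner inner_vec_def pos_part_def by (simp add: power2_eq_square)

lemma pos_part_le_norm: "max 0 (a $ j) \<le> norm (pos_part a)"
  using component_le_norm_cart[of "pos_part a" j] by (simp add: pos_part_def)

text \<open>The positive part is nonexpansive, so the multiplier perturbs the penalty gradient only by a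
  bounded amount, whatever \<open>\<beta>\<close> is.\<close>

lemma norm_pos_part_diff_le:
  assumes "0 \<le> \<beta>"
  shows "norm (pos_part (z + \<beta> *\<^sub>R a) - \<beta> *\<^sub>R pos_part a) \<le> norm z"
proof (rule norm_le_componentwise_cart)
  fix i
  show "norm ((pos_part (z + \<beta> *\<^sub>R a) - \<beta> *\<^sub>R pos_part a) $ i) \<le> norm (z $ i)"
  proof (cases "0 \<le> a $ i")
    case True
    then have "0 \<le> \<beta> * a $ i" using assms by simp
    then show ?thesis using True by (simp add: pos_part_def max_def)
  next
    case False
    then have "\<beta> * a $ i \<le> 0" using assms by (simp add: mult_nonneg_nonpos)
    then show ?thesis using False by (simp add: pos_part_def max_def)
  qed
qed

lemma DERIV_max0_sq: "((\<lambda>t::real. (max 0 t)\<^sup>2) has_real_derivative 2 * max 0 t) (at t)"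
proof -
  consider "t < 0" | "t = 0" | "0 < t" by linarith
  then show ?thesis
  proof cases
    case 1
    have "((\<lambda>_. 0) has_real_derivative 2 * max 0 t) (at t)" using 1 by simp
    then show ?thesis
      by (rule has_field_derivative_transform_within_open[where S = "{..<0}"]) (use 1 in auto)
  next
    case 2
    have "(\<lambda>h::real. (max 0 h)\<^sup>2 / h) \<midarrow>0\<rightarrow> 0"
    proof (rule Lim_null_comparison[where g = abs])
      show "\<forall>\<^sub>F x in at 0. norm ((max 0 x)\<^sup>2 / x) \<le> \<bar>x::real\<bar>"
        by (intro always_eventually allI) (auto simp: max_def power2_eq_square)
      show "(abs \<longlongrightarrow> (0::real)) (at 0)" by (intro tendsto_rabs_zero tendsto_ident_at)
    qed
    then show ?thesis using 2 by (simp add: DERIV_def)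
  next
    case 3
    have "((\<lambda>t. t\<^sup>2) has_real_derivative 2 * max 0 t) (at t)"
      using 3 by (auto intro!: derivative_eq_intros)
    then show ?thesis
      by (rule has_field_derivative_transform_within_open[where S = "{0<..}"]) (use 3 in auto)
  qed
qed

lemma max0_sq_above_tangent:
  fixes a b :: real
  shows "(max 0 a)\<^sup>2 + 2 * max 0 a * (b - a) \<le> (max 0 b)\<^sup>2"
proof (cases "0 \<le> a")
  case True
  have "0 \<le> (max 0 b - a)\<^sup>2" by simp
  moreover have "a * b \<le> a * max 0 b" using True by (intro mult_left_mono) auto
  ultimately show ?thesis using True by (simp add: power2_eq_square algebra_simps)
qed simp

lemma L_smooth_on_nonneg:
  fixes F :: "real ^ 'n::finite \<Rightarrow> real"
  assumes "L_smooth_on L UNIV F"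
  shows "0 \<le> L"
proof -
  let ?x = "axis undefined 1 :: real ^ 'n"
  have "0 \<le> norm (grad F ?x - grad F 0)" by simp
  also have "\<dots> \<le> L * norm (?x - 0)" using assms unfolding L_smooth_on_def by blast
  also have "\<dots> = L" by (simp add: norm_axis_1)
  finally show ?thesis .
qed

locale convex_constrained_problem =
  fixes P :: "('n::finite, 'l::finite, 'm::finite) problem"
  assumes g_diff: "\<And>x. obj_g P differentiable at x"
    and f_convex: "\<And>j. convex_on UNIV (\<lambda>x. con_f P x $ j)"
    and f_smooth: "\<And>j. L_smooth_on (Lf P j) UNIV (\<lambda>x. con_f P x $ j)"
    and g_smooth: "L_smooth_on (L0 P) UNIV (obj_g P)"
    and rho_pos: "rho0 P > 0" and g_weakly_convex: "weakly_convex (rho0 P) (obj_g P)"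
    and h_convex: "closed_convex_fun (obj_h P)"
    and h_dom: "compact (edom (obj_h P))"
begin

sublocale compact_convex_fun "obj_h P"
  by unfold_locales (rule h_convex, rule h_dom)

abbreviation A :: "real ^ 'n ^ 'l" where "A \<equiv> mat_A P"
abbreviation r :: "real ^ 'n \<Rightarrow> real ^ 'l" where "r \<equiv> eq_res P"
abbreviation f :: "real ^ 'n \<Rightarrow> real ^ 'm" where "f \<equiv> con_f P"

definition df :: "'m \<Rightarrow> real ^ 'n \<Rightarrow> real ^ 'n" where "df j x = grad (\<lambda>x. f x $ j) x"

lemma GDERIV_f: "GDERIV (\<lambda>x. f x $ j) x :> df j x"
  using f_smooth[of j] unfolding df_def L_smooth_on_def by (intro GDERIV_grad) simp

lemma transpose_Jf: "transpose (Jf P x) *v z = (\<Sum>j\<in>UNIV. z $ j *\<^sub>R df j x)"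
proof -
  have "(f has_derivative (\<lambda>h. \<chi> j. h \<bullet> df j x)) (at x)"
    unfolding has_derivative_componentwise_within[of f]
  proof
    fix i :: "real ^ 'm" assume "i \<in> Basis"
    then obtain j where "i = axis j 1" unfolding Basis_vec_def by auto
    then show "((\<lambda>x. f x \<bullet> i) has_derivative (\<lambda>h. (\<chi> j. h \<bullet> df j x) \<bullet> i)) (at x)"
      using GDERIV_f[of j x] by (simp add: inner_axis gderiv_def)
  qed
  then have "frechet_derivative f (at x) = (\<lambda>h. \<chi> j. h \<bullet> df j x)"
    by (rule frechet_derivative_at[symmetric])
  then have J: "Jf P x = matrix (\<lambda>h. \<chi> j. h \<bullet> df j x)" by (simp add: Jf_def jacobian_def)
  have "(transpose (Jf P x) *v z) $ i = (\<Sum>j\<in>UNIV. z $ j *\<^sub>R df j x) $ i" for i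
    unfolding J matrix_def transpose_def matrix_vector_mult_def
    by (simp add: inner_axis' mult.commute)
  then show ?thesis by (simp add: vec_eq_iff)
qed

lemma norm_transpose_Jf_le:
  assumes "\<And>j. norm (df j x) \<le> M"
  shows "norm (transpose (Jf P x) *v z) \<le> real CARD('m) * M * norm z"
proof -
  have "norm (transpose (Jf P x) *v z) \<le> (\<Sum>j\<in>(UNIV::'m set). norm (z $ j *\<^sub>R df j x))"
    unfolding transpose_Jf by (rule norm_sum)
  also have "\<dots> \<le> (\<Sum>j\<in>(UNIV::'m set). norm z * M)"
  proof (rule sum_mono)
    fix j
    show "norm (z $ j *\<^sub>R df j x) \<le> norm z * M"
      unfolding norm_scaleR using component_le_norm_cart[of z j] assms[of j] by (intro mult_mono) auto
  qed
  also have "\<dots> = real CARD('m) * M * norm z" by simp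
  finally show ?thesis .
qed

definition al_grad :: "real \<Rightarrow> real ^ 'l \<Rightarrow> real ^ 'm \<Rightarrow> real ^ 'n \<Rightarrow> real ^ 'n" where
  "al_grad \<beta> y z x = transpose A *v (y + \<beta> *\<^sub>R r x) + transpose (Jf P x) *v pos_part (z + \<beta> *\<^sub>R f x)"

lemma inner_transpose: "(transpose A *v u) \<bullet> d = u \<bullet> (A *v d)"
  by (metis dot_lmul_matrix transpose_matrix_vector)

lemma al_grad_inner:
  "al_grad \<beta> y z x \<bullet> d = (y + \<beta> *\<^sub>R r x) \<bullet> (A *v d)
     + (\<Sum>j\<in>UNIV. max 0 (z $ j + \<beta> * f x $ j) * (df j x \<bullet> d))"
  unfolding al_grad_def inner_add_left inner_transpose transpose_Jf inner_sum_left
  by (simp add: pos_part_def)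

lemma al_penalty_eq:
  "al_penalty P \<beta> y z x = y \<bullet> r x + \<beta> / 2 * (r x \<bullet> r x)
     + 1 / (2 * \<beta>) * ((\<Sum>j\<in>UNIV. (max 0 (z $ j + \<beta> * f x $ j))\<^sup>2) - (norm z)\<^sup>2)"
  unfolding al_penalty_def norm_pos_part_sq by (simp add: power2_norm_eq_inner)

lemma GDERIV_al_penalty:
  assumes beta: "0 < \<beta>"
  shows "GDERIV (al_penalty P \<beta> y z) x :> al_grad \<beta> y z x"
proof -
  have dr: "(r has_derivative (\<lambda>d. A *v d)) (at x)"
    unfolding eq_res_def[abs_def]
    by (auto intro!: derivative_eq_intros bounded_linear_imp_has_derivative
        matrix_vector_mul_bounded_linear)
  have sq: "((\<lambda>x. (max 0 (z $ j + \<beta> * f x $ j))\<^sup>2) has_derivative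
      (\<lambda>d. 2 * max 0 (z $ j + \<beta> * f x $ j) * (\<beta> * (d \<bullet> df j x)))) (at x)" for j
  proof -
    have "((\<lambda>x. z $ j + \<beta> * f x $ j) has_derivative (\<lambda>d. \<beta> * (d \<bullet> df j x))) (at x)"
      using GDERIV_f[of j x] unfolding gderiv_def by (auto intro!: derivative_eq_intros)
    from has_derivative_compose[OF this DERIV_max0_sq[unfolded has_field_derivative_def]]
    show ?thesis .
  qed
  have "((\<lambda>x. y \<bullet> r x + \<beta> / 2 * (r x \<bullet> r x)
        + 1 / (2 * \<beta>) * ((\<Sum>j\<in>UNIV. (max 0 (z $ j + \<beta> * f x $ j))\<^sup>2) - (norm z)\<^sup>2))
      has_derivative (\<lambda>d. y \<bullet> (A *v d) + \<beta> / 2 * (r x \<bullet> (A *v d) + (A *v d) \<bullet> r x)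
        + 1 / (2 * \<beta>) * ((\<Sum>j\<in>UNIV. 2 * max 0 (z $ j + \<beta> * f x $ j) * (\<beta> * (d \<bullet> df j x))) - 0))) (at x)"
    by (intro has_derivative_add has_derivative_mult_right has_derivative_diff has_derivative_sum
        sq has_derivative_const has_derivative_inner_right has_derivative_inner dr)
  also have "(\<lambda>d. y \<bullet> (A *v d) + \<beta> / 2 * (r x \<bullet> (A *v d) + (A *v d) \<bullet> r x)
        + 1 / (2 * \<beta>) * ((\<Sum>j\<in>UNIV. 2 * max 0 (z $ j + \<beta> * f x $ j) * (\<beta> * (d \<bullet> df j x))) - 0))
      = (\<lambda>d. d \<bullet> al_grad \<beta> y z x)"
  proof
    fix d
    have "1 / (2 * \<beta>) * (\<Sum>j\<in>UNIV. 2 * max 0 (z $ j + \<beta> * f x $ j) * (\<beta> * (d \<bullet> df j x)))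
        = (\<Sum>j\<in>UNIV. max 0 (z $ j + \<beta> * f x $ j) * (df j x \<bullet> d))"
      unfolding sum_distrib_left using beta by (intro sum.cong) (auto simp: inner_commute)
    then show "y \<bullet> (A *v d) + \<beta> / 2 * (r x \<bullet> (A *v d) + (A *v d) \<bullet> r x)
        + 1 / (2 * \<beta>) * ((\<Sum>j\<in>UNIV. 2 * max 0 (z $ j + \<beta> * f x $ j) * (\<beta> * (d \<bullet> df j x))) - 0)
      = d \<bullet> al_grad \<beta> y z x"
      unfolding inner_commute[of d] al_grad_inner
      by (simp add: inner_add_left inner_commute[of "A *v d"])
  qed
  finally show ?thesis unfolding gderiv_def al_penalty_eq[abs_def] .
qed

text \<open>This is the place where convexity of the constraints is used: the penalty, whose curvature
  grows with \<open>\<beta>\<close>, does not add to the weak convexity constant.\<close>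

lemma al_penalty_above_tangent:
  assumes beta: "0 < \<beta>"
  shows "al_penalty P \<beta> y z x + al_grad \<beta> y z x \<bullet> (x' - x) \<le> al_penalty P \<beta> y z x'"
proof -
  let ?m = "\<lambda>x j. max 0 (z $ j + \<beta> * f x $ j)"
  define d where "d = A *v (x' - x)"
  have r': "r x' = r x + d" unfolding eq_res_def d_def by (simp add: matrix_vector_mult_diff_distrib)
  have "r x' \<bullet> r x' = r x \<bullet> r x + 2 * (r x \<bullet> d) + d \<bullet> d"
    unfolding r' by (simp add: inner_add_left inner_add_right inner_commute[of d "r x"])
  then have "r x \<bullet> r x + 2 * (r x \<bullet> d) \<le> r x' \<bullet> r x'" by simp
  then have "\<beta> / 2 * (r x \<bullet> r x + 2 * (r x \<bullet> d)) \<le> \<beta> / 2 * (r x' \<bullet> r x')"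
    using beta by (intro mult_left_mono) auto
  then have 1: "\<beta> / 2 * (r x \<bullet> r x) + \<beta> * (r x \<bullet> d) \<le> \<beta> / 2 * (r x' \<bullet> r x')"
    by (simp add: distrib_left)
  have 2: "y \<bullet> r x' = y \<bullet> r x + y \<bullet> d" unfolding r' by (rule inner_add_right)
  have "(\<Sum>j\<in>UNIV. (?m x j)\<^sup>2 + 2 * \<beta> * (?m x j * (df j x \<bullet> (x' - x)))) \<le> (\<Sum>j\<in>UNIV. (?m x' j)\<^sup>2)"
  proof (rule sum_mono)
    fix j
    have "f x $ j + df j x \<bullet> (x' - x) \<le> f x' $ j"
      by (rule convex_above_tangent[OF f_convex GDERIV_f])
    then have "\<beta> * (df j x \<bullet> (x' - x)) \<le> \<beta> * (f x' $ j - f x $ j)"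
      using beta by (intro mult_left_mono) auto
    then have "2 * ?m x j * (\<beta> * (df j x \<bullet> (x' - x)))
        \<le> 2 * ?m x j * ((z $ j + \<beta> * f x' $ j) - (z $ j + \<beta> * f x $ j))"
      by (intro mult_left_mono) (auto simp: right_diff_distrib)
    then show "(?m x j)\<^sup>2 + 2 * \<beta> * (?m x j * (df j x \<bullet> (x' - x))) \<le> (?m x' j)\<^sup>2"
      using max0_sq_above_tangent[of "z $ j + \<beta> * f x $ j" "z $ j + \<beta> * f x' $ j"]
      by (simp add: mult_ac)
  qed
  then have "1 / (2 * \<beta>) * ((\<Sum>j\<in>UNIV. (?m x j)\<^sup>2) + 2 * \<beta> * (\<Sum>j\<in>UNIV. ?m x j * (df j x \<bullet> (x' - x))))
      \<le> 1 / (2 * \<beta>) * (\<Sum>j\<in>UNIV. (?m x' j)\<^sup>2)"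
    using beta unfolding sum.distrib sum_distrib_left[symmetric] by (intro mult_left_mono) auto
  then have 3: "1 / (2 * \<beta>) * (\<Sum>j\<in>UNIV. (?m x j)\<^sup>2) + (\<Sum>j\<in>UNIV. ?m x j * (df j x \<bullet> (x' - x)))
      \<le> 1 / (2 * \<beta>) * (\<Sum>j\<in>UNIV. (?m x' j)\<^sup>2)"
    using beta by (simp add: distrib_left)
  have "al_grad \<beta> y z x \<bullet> (x' - x) = y \<bullet> d + \<beta> * (r x \<bullet> d) + (\<Sum>j\<in>UNIV. ?m x j * (df j x \<bullet> (x' - x)))"
    unfolding al_grad_inner d_def by (simp add: inner_add_left)
  then show ?thesis
    using 1 2 3 unfolding al_penalty_eq right_diff_distrib by linarith
qed

lemma GDERIV_al_smooth:
  "0 < \<beta> \<Longrightarrow> GDERIV (al_smooth P \<beta> y z) x :> grad (obj_g P) x + al_grad \<beta> y z x"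
  unfolding al_smooth_def[abs_def] by (intro GDERIV_add GDERIV_grad g_diff GDERIV_al_penalty)

lemma grad_al_smooth:
  "0 < \<beta> \<Longrightarrow> grad (al_smooth P \<beta> y z) x = grad (obj_g P) x + al_grad \<beta> y z x"
  by (rule grad_eqI[OF GDERIV_al_smooth])

lemma al_smooth_differentiable: "0 < \<beta> \<Longrightarrow> al_smooth P \<beta> y z differentiable at x"
  using GDERIV_al_smooth unfolding gderiv_def differentiable_def by blast

lemma al_smooth_quad_below:
  assumes beta: "0 < \<beta>"
  shows "quad_below (- rho0 P) (al_smooth P \<beta> y z)"
  unfolding quad_below_def grad_al_smooth[OF beta]
proof (intro allI)
  fix x x'
  have "obj_g P x + grad (obj_g P) x \<bullet> (x' - x) + - rho0 P / 2 * (norm (x' - x))\<^sup>2 \<le> obj_g P x'"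
    using weakly_convex_imp_quad_below[OF g_weakly_convex g_diff] unfolding quad_below_def by blast
  with al_penalty_above_tangent[OF beta, of y z x x']
  show "al_smooth P \<beta> y z x + (grad (obj_g P) x + al_grad \<beta> y z x) \<bullet> (x' - x)
      + - rho0 P / 2 * (norm (x' - x))\<^sup>2 \<le> al_smooth P \<beta> y z x'"
    unfolding al_smooth_def inner_add_left by linarith
qed

subsection \<open>Uniform bounds on the domain\<close>

lemma grad_bounded_on_dom:
  assumes "L_smooth_on L UNIV F"
  obtains M where "\<And>x. x \<in> edom (obj_h P) \<Longrightarrow> norm (grad F x) \<le> M"
proof -
  obtain x0 where x0: "x0 \<in> edom (obj_h P)" using dom_nonempty by blast
  obtain d where d: "\<And>x y. x \<in> edom (obj_h P) \<Longrightarrow> y \<in> edom (obj_h P) \<Longrightarrow> dist x y \<le> d"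
    using compact_imp_bounded[OF h_dom] unfolding bounded_two_points by blast
  have "norm (grad F x) \<le> norm (grad F x0) + L * d" if x: "x \<in> edom (obj_h P)" for x
  proof -
    have "norm (grad F x - grad F x0) \<le> L * norm (x - x0)"
      using assms unfolding L_smooth_on_def by blast
    also have "\<dots> \<le> L * d"
      using d[OF x x0] L_smooth_on_nonneg[OF assms] by (intro mult_left_mono) (auto simp: dist_norm)
    finally show ?thesis using norm_triangle_ineq2[of "grad F x" "grad F x0"] by linarith
  qed
  then show ?thesis by (rule that)
qed

lemma continuous_bounded_on_dom:
  fixes F :: "real ^ 'n \<Rightarrow> 'b::real_normed_vector"
  assumes "continuous_on UNIV F"
  obtains M where "\<And>x. x \<in> edom (obj_h P) \<Longrightarrow> norm (F x) \<le> M"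
proof -
  have "bounded (F ` edom (obj_h P))"
    using assms h_dom by (intro compact_imp_bounded compact_continuous_image) (auto intro: continuous_on_subset)
  then show ?thesis using that unfolding bounded_iff by auto
qed

lemma uniform_bounds:
  obtains M where "0 < M"
    "\<And>x. x \<in> edom (obj_h P) \<Longrightarrow> \<bar>obj_g P x\<bar> \<le> M \<and> norm (grad (obj_g P) x) \<le> M \<and> norm (r x) \<le> M
       \<and> (\<forall>j. \<bar>f x $ j\<bar> \<le> M \<and> norm (df j x) \<le> M) \<and> - M \<le> hr x"
    "\<And>x y. x \<in> edom (obj_h P) \<Longrightarrow> y \<in> edom (obj_h P) \<Longrightarrow> norm (x - y) \<le> M"
    "\<And>u. norm (transpose A *v u) \<le> M * norm u"
proof -
  have cont: "continuous_on UNIV F" if "\<And>x. F differentiable at x" for F :: "real ^ 'n \<Rightarrow> real"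
    using that by (auto intro!: continuous_at_imp_continuous_on differentiable_imp_continuous_within)
  obtain M1 where M1: "\<And>x. x \<in> edom (obj_h P) \<Longrightarrow> norm (obj_g P x) \<le> M1"
    by (rule continuous_bounded_on_dom[OF cont[OF g_diff]]) blast
  obtain M2 where M2: "\<And>x. x \<in> edom (obj_h P) \<Longrightarrow> norm (grad (obj_g P) x) \<le> M2"
    by (rule grad_bounded_on_dom[OF g_smooth]) blast
  have "continuous_on UNIV r"
    unfolding eq_res_def[abs_def] by (intro continuous_intros)
  then obtain M3 where M3: "\<And>x. x \<in> edom (obj_h P) \<Longrightarrow> norm (r x) \<le> M3"
    by (rule continuous_bounded_on_dom) blast
  have "\<exists>M. \<forall>x\<in>edom (obj_h P). \<bar>f x $ j\<bar> \<le> M" for j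
  proof -
    have "(\<lambda>x. f x $ j) differentiable at x" for x using f_smooth[of j] by (simp add: L_smooth_on_def)
    from continuous_bounded_on_dom[OF cont[OF this]] show ?thesis by (metis real_norm_def)
  qed
  then obtain M4 where M4: "\<And>j x. x \<in> edom (obj_h P) \<Longrightarrow> \<bar>f x $ j\<bar> \<le> M4 j" by metis
  have "\<exists>M. \<forall>x\<in>edom (obj_h P). norm (df j x) \<le> M" for j
    using grad_bounded_on_dom[OF f_smooth[of j]] unfolding df_def by metis
  then obtain M5 where M5: "\<And>j x. x \<in> edom (obj_h P) \<Longrightarrow> norm (df j x) \<le> M5 j" by metis
  obtain M6 where M6: "\<And>x. x \<in> edom (obj_h P) \<Longrightarrow> M6 \<le> hr x" using hr_bounded_below by blast
  obtain M7 where M7: "\<And>x y. x \<in> edom (obj_h P) \<Longrightarrow> y \<in> edom (obj_h P) \<Longrightarrow> dist x y \<le> M7"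
    using compact_imp_bounded[OF h_dom] unfolding bounded_two_points by blast
  obtain M8 where M8: "\<And>u. norm (transpose A *v u) \<le> norm u * M8"
    using bounded_linear.bounded[OF matrix_vector_mul_bounded_linear[of "transpose A"]] by blast
  define M where "M = 1 + \<bar>M1\<bar> + \<bar>M2\<bar> + \<bar>M3\<bar> + (\<Sum>j\<in>UNIV. \<bar>M4 j\<bar>) + (\<Sum>j\<in>UNIV. \<bar>M5 j\<bar>) + \<bar>M6\<bar> + \<bar>M7\<bar> + \<bar>M8\<bar>"
  have s4: "\<bar>M4 j\<bar> \<le> (\<Sum>j\<in>UNIV. \<bar>M4 j\<bar>)" and s5: "\<bar>M5 j\<bar> \<le> (\<Sum>j\<in>UNIV. \<bar>M5 j\<bar>)" for j
    by (rule member_le_sum; simp)+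
  have n: "0 \<le> (\<Sum>j\<in>UNIV. \<bar>M4 j\<bar>)" "0 \<le> (\<Sum>j\<in>UNIV. \<bar>M5 j\<bar>)" by (rule sum_nonneg; simp)+
  show ?thesis
  proof (rule that[of M])
    show "0 < M" unfolding M_def using n by linarith
    fix x assume x: "x \<in> edom (obj_h P)"
    have "\<bar>obj_g P x\<bar> \<le> M" using M1[OF x] n unfolding M_def real_norm_def by linarith
    moreover have "norm (grad (obj_g P) x) \<le> M" using M2[OF x] n unfolding M_def by linarith
    moreover have "norm (r x) \<le> M" using M3[OF x] n unfolding M_def by linarith
    moreover have "\<bar>f x $ j\<bar> \<le> M" for j using M4[OF x, of j] s4[of j] n unfolding M_def by linarith
    moreover have "norm (df j x) \<le> M" for j using M5[OF x, of j] s5[of j] n unfolding M_def by linarith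
    moreover have "- M \<le> hr x" using M6[OF x] n unfolding M_def by linarith
    ultimately show "\<bar>obj_g P x\<bar> \<le> M \<and> norm (grad (obj_g P) x) \<le> M \<and> norm (r x) \<le> M
       \<and> (\<forall>j. \<bar>f x $ j\<bar> \<le> M \<and> norm (df j x) \<le> M) \<and> - M \<le> hr x" by blast
  next
    fix x y assume "x \<in> edom (obj_h P)" "y \<in> edom (obj_h P)"
    then show "norm (x - y) \<le> M" using M7[of x y] n unfolding M_def dist_norm by linarith
  next
    fix u :: "real ^ 'l"
    have "M8 \<le> M" using n unfolding M_def by linarith
    then have "norm u * M8 \<le> norm u * M" by (rule mult_left_mono) simp
    then show "norm (transpose A *v u) \<le> M * norm u" using M8[of u] by (simp add: mult.commute)
  qed
qed

lemma Bf_nonneg: "0 \<le> Bf P j"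
proof -
  obtain M where M: "\<And>x. x \<in> edom (obj_h P) \<Longrightarrow> \<bar>f x $ j\<bar> \<le> M \<and> norm (df j x) \<le> M"
    using uniform_bounds by metis
  obtain x0 where x0: "x0 \<in> edom (obj_h P)" using dom_nonempty by blast
  have "0 \<le> max \<bar>f x0 $ j\<bar> (norm (df j x0))" by simp
  also have "\<dots> \<le> Bf P j"
    unfolding Bf_def df_def
    by (rule cSUP_upper[OF x0]) (use M in \<open>auto intro!: bdd_aboveI2[of _ _ M] simp: df_def\<close>)
  finally show ?thesis .
qed

lemma Lhat_nonneg:
  assumes "0 \<le> \<beta>"
  shows "0 \<le> Lhat P \<beta> z"
proof -
  have "0 \<le> Lf P i" for i by (rule L_smooth_on_nonneg[OF f_smooth])
  moreover have "0 \<le> L0 P" by (rule L_smooth_on_nonneg[OF g_smooth])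
  moreover have "0 \<le> onorm ((*v) (transpose A ** A))"
    by (rule onorm_pos_le) (rule matrix_vector_mul_bounded_linear)
  ultimately show ?thesis
    unfolding Lhat_def using assms Bf_nonneg
    by (intro add_nonneg_nonneg sum_nonneg mult_nonneg_nonneg) auto
qed

lemma Lhat_le_affine:
  obtains a b where "0 \<le> a" "0 \<le> b"
    "\<And>\<beta> z. (\<And>i. \<bar>z $ i\<bar> \<le> Y) \<Longrightarrow> Lhat P \<beta> z \<le> a + b * \<beta>"
proof -
  define a where "a = L0 P + (\<Sum>i\<in>UNIV. Lf P i * \<bar>Y\<bar>)"
  define b where "b = onorm ((*v) (transpose A ** A)) + (\<Sum>i\<in>UNIV. Bf P i * (Bf P i + Lf P i))"
  have Lf: "0 \<le> Lf P i" for i by (rule L_smooth_on_nonneg[OF f_smooth])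
  have "0 \<le> a"
    unfolding a_def using Lf L_smooth_on_nonneg[OF g_smooth]
    by (intro add_nonneg_nonneg sum_nonneg mult_nonneg_nonneg) auto
  moreover have "0 \<le> b"
    unfolding b_def using Lf Bf_nonneg onorm_pos_le[OF matrix_vector_mul_bounded_linear[of "transpose A ** A"]]
    by (intro add_nonneg_nonneg sum_nonneg mult_nonneg_nonneg) auto
  moreover have "Lhat P \<beta> z \<le> a + b * \<beta>" if z: "\<And>i. \<bar>z $ i\<bar> \<le> Y" for \<beta> z
  proof -
    have "(\<Sum>i\<in>UNIV. \<beta> * Bf P i * (Bf P i + Lf P i) + Lf P i * \<bar>z $ i\<bar>)
        \<le> (\<Sum>i\<in>UNIV. \<beta> * (Bf P i * (Bf P i + Lf P i)) + Lf P i * \<bar>Y\<bar>)"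
    proof (rule sum_mono)
      fix i
      have "\<bar>z $ i\<bar> \<le> \<bar>Y\<bar>" using z[of i] by linarith
      then have "Lf P i * \<bar>z $ i\<bar> \<le> Lf P i * \<bar>Y\<bar>" using Lf by (rule mult_left_mono)
      then show "\<beta> * Bf P i * (Bf P i + Lf P i) + Lf P i * \<bar>z $ i\<bar>
          \<le> \<beta> * (Bf P i * (Bf P i + Lf P i)) + Lf P i * \<bar>Y\<bar>" by (simp add: mult.assoc)
    qed
    also have "\<dots> = (\<Sum>i\<in>UNIV. Bf P i * (Bf P i + Lf P i)) * \<beta> + (\<Sum>i\<in>UNIV. Lf P i * \<bar>Y\<bar>)"
      unfolding sum.distrib sum_distrib_left[symmetric] by (simp only: mult.commute)
    finally have sum: "(\<Sum>i\<in>UNIV. \<beta> * Bf P i * (Bf P i + Lf P i) + Lf P i * \<bar>z $ i\<bar>)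
        \<le> (\<Sum>i\<in>UNIV. Bf P i * (Bf P i + Lf P i)) * \<beta> + (\<Sum>i\<in>UNIV. Lf P i * \<bar>Y\<bar>)" .
    have "b * \<beta> = onorm ((*v) (transpose A ** A)) * \<beta> + (\<Sum>i\<in>UNIV. Bf P i * (Bf P i + Lf P i)) * \<beta>"
      unfolding b_def by (rule distrib_right)
    with sum show ?thesis
      unfolding Lhat_def a_def by (simp only: mult.commute[of \<beta> "onorm _"])
  qed
  ultimately show ?thesis by (rule that)
qed

end

section \<open>Multipliers and residuals of the outer iteration\<close>

text \<open>The step sizes are chosen such that the multipliers grow by at most a convergent series; its
  partial sums are compared with the telescoping sum of \<open>2 / ln (k + 1) - 2 / ln (k + 2)\<close>.\<close>

lemma inverse_log_squared_sum_le:
  "(\<Sum>i<Suc k. 1 / (real (i + 1) * (ln (real (i + 2)))\<^sup>2)) \<le> 1 / (ln 2)\<^sup>2 + 2 / ln 2 - 2 / ln (real (k + 2))"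
proof (induction k)
  case (Suc k)
  define a where "a = ln (real (k + 2))"
  define b where "b = ln (real (k + 3))"
  have a0: "0 < a" unfolding a_def by simp
  have ab: "a \<le> b" unfolding a_def b_def by simp
  have b0: "0 < b" using a0 ab by linarith
  have "ln (real (k + 2) / real (k + 3)) \<le> real (k + 2) / real (k + 3) - 1"
    by (rule ln_le_minus_one) simp
  also have "real (k + 2) / real (k + 3) - 1 = - (1 / real (k + 3))" by (simp add: field_simps)
  also have "ln (real (k + 2) / real (k + 3)) = a - b" unfolding a_def b_def by (rule ln_divide_pos) simp_all
  finally have gap: "1 / real (k + 3) \<le> b - a" by simp
  have k2: "0 < real (k + 2) * b\<^sup>2" using b0 by simp
  have "1 / (real (k + 2) * b\<^sup>2) \<le> 2 * (1 / real (k + 3)) / b\<^sup>2"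
  proof -
    have "1 / real (k + 2) \<le> 2 * (1 / real (k + 3))" by (simp add: field_simps)
    then have "1 / real (k + 2) / b\<^sup>2 \<le> 2 * (1 / real (k + 3)) / b\<^sup>2" by (rule divide_right_mono) simp
    then show ?thesis by simp
  qed
  also have "\<dots> \<le> 2 * (b - a) / b\<^sup>2" using gap by (intro divide_right_mono mult_left_mono) auto
  also have "\<dots> \<le> 2 * (b - a) / (a * b)"
    unfolding power2_eq_square using a0 b0 ab by (intro divide_left_mono mult_right_mono mult_pos_pos) auto
  also have "\<dots> = 2 / a - 2 / b" using a0 b0 by (simp add: field_simps)
  finally have step: "1 / (real (k + 2) * b\<^sup>2) \<le> 2 / a - 2 / b" .
  have "(\<Sum>i<Suc (Suc k). 1 / (real (i + 1) * (ln (real (i + 2)))\<^sup>2))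
      = (\<Sum>i<Suc k. 1 / (real (i + 1) * (ln (real (i + 2)))\<^sup>2)) + 1 / (real (k + 2) * b\<^sup>2)"
    by (simp add: b_def numeral_3_eq_3)
  also have "\<dots> \<le> (1 / (ln 2)\<^sup>2 + 2 / ln 2 - 2 / a) + (2 / a - 2 / b)"
    using Suc.IH step unfolding a_def by (rule add_mono)
  finally show ?case unfolding b_def by (simp add: numeral_3_eq_3)
qed simp

locale ialm_constants = convex_constrained_problem P
  for P :: "('n::finite, 'l::finite, 'm::finite) problem" +
  fixes Q :: "'n params" and v E M m :: real
  assumes params: "x_init Q \<in> edom (obj_h P)" "beta0 Q > 0" "sigma Q > 1" "w0 Q > 0"
    and v_pos: "v > 0" and E_pos: "E > 0" and M_pos: "0 < M"
    and M_bounds: "\<And>x. x \<in> edom (obj_h P) \<Longrightarrow> \<bar>obj_g P x\<bar> \<le> M \<and> norm (grad (obj_g P) x) \<le> M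
       \<and> norm (r x) \<le> M \<and> (\<forall>j. \<bar>f x $ j\<bar> \<le> M \<and> norm (df j x) \<le> M) \<and> - M \<le> hr x"
    and M_diam: "\<And>x y. x \<in> edom (obj_h P) \<Longrightarrow> y \<in> edom (obj_h P) \<Longrightarrow> norm (x - y) \<le> M"
    and M_transpose: "\<And>u. norm (transpose A *v u) \<le> M * norm u"
    and m_eq: "m = real CARD('m)"
begin

definition multiplier_bound :: "nat \<Rightarrow> real" where
  "multiplier_bound k = w0 Q * (\<Sum>i<k. gamma P Q i)"

definition Y :: real where
  "Y = w0 Q * ((ln 2)\<^sup>2 * min (norm (r (x_init Q))) (norm (pos_part (f (x_init Q))))
     * (1 / (ln 2)\<^sup>2 + 2 / ln 2))"

text \<open>\<open>C / \<beta>\<close> bounds the residuals after a step with penalty \<open>\<beta>\<close>, \<open>R / \<beta>\<close> those before it,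
  \<open>Y\<close> the multipliers, \<open>\<Delta>\<close> the gap in the augmented Lagrangian before the step, and the point after it is an
  \<open>\<epsilon>\<close>-KKT point as soon as \<open>\<beta> \<ge> C_KKT / \<epsilon>\<close>. All are uniform in \<open>\<epsilon> \<le> E\<close>.\<close>

definition C :: real where "C = (E + M + M * Y + m * M * (m * Y)) / v"
definition R :: real where
  "R = max (sigma Q * C) (beta0 Q * max (norm (r (x_init Q))) (norm (pos_part (f (x_init Q)))))"
definition h_bound :: real where
  "h_bound = hr (x_init Q) + M * (E + M + M * (Y + C) + m * M * (m * Y + C))"
definition \<Delta> :: real where
  "\<Delta> = (M + Y * M + R\<^sup>2 / (2 * beta0 Q) + (m * Y + R)\<^sup>2 / (2 * beta0 Q) + h_bound)
     + (M + Y * M + (m * Y)\<^sup>2 / (2 * beta0 Q) + M)"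
definition C_KKT :: real where "C_KKT = C + m * (Y + C)\<^sup>2"

lemma gamma_nonneg: "0 \<le> gamma P Q k"
  unfolding gamma_def by (intro divide_nonneg_nonneg mult_nonneg_nonneg) auto

lemma multiplier_bound_le: "multiplier_bound k \<le> Y"
proof -
  let ?c = "(ln 2)\<^sup>2 * min (norm (r (x_init Q))) (norm (pos_part (f (x_init Q))))"
  have c: "0 \<le> ?c" by (intro mult_nonneg_nonneg) auto
  have "(\<Sum>i<k. gamma P Q i) \<le> (\<Sum>i<Suc k. gamma P Q i)" using gamma_nonneg by simp
  also have "\<dots> = ?c * (\<Sum>i<Suc k. 1 / (real (i + 1) * (ln (real (i + 2)))\<^sup>2))"
    unfolding sum_distrib_left gamma_def by (intro sum.cong) simp_all
  also have "\<dots> \<le> ?c * (1 / (ln 2)\<^sup>2 + 2 / ln 2)"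
  proof (rule mult_left_mono[OF _ c])
    have "0 \<le> 2 / ln (real (k + 2))" by simp
    with inverse_log_squared_sum_le[of k]
    show "(\<Sum>i<Suc k. 1 / (real (i + 1) * (ln (real (i + 2)))\<^sup>2)) \<le> 1 / (ln 2)\<^sup>2 + 2 / ln 2" by linarith
  qed
  finally have "w0 Q * (\<Sum>i<k. gamma P Q i) \<le> w0 Q * (?c * (1 / (ln 2)\<^sup>2 + 2 / ln 2))"
    using params by (intro mult_left_mono) auto
  then show ?thesis unfolding multiplier_bound_def Y_def .
qed

lemma multiplier_bound_Suc: "multiplier_bound (Suc k) = multiplier_bound k + w0 Q * gamma P Q k"
  by (simp add: multiplier_bound_def distrib_left)

lemma beta_pos: "0 < beta Q k" and beta_ge: "beta0 Q \<le> beta Q k" and beta_Suc: "beta Q (Suc k) = sigma Q * beta Q k"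
  and beta_mono: "i \<le> j \<Longrightarrow> beta Q i \<le> beta Q j"
  using params by (auto simp: beta_def one_le_power power_increasing)

lemma Y_nonneg: "0 \<le> Y"
  using multiplier_bound_le[of 0] by (simp add: multiplier_bound_def)

lemma C_nonneg: "0 \<le> C"
  unfolding C_def using E_pos M_pos Y_nonneg v_pos
  by (intro divide_nonneg_pos add_nonneg_nonneg mult_nonneg_nonneg) (auto simp: m_eq)

lemma step_w_bounds:
  assumes x: "d = max (norm (r x)) (norm (pos_part (f x)))"
  shows "0 \<le> step_w P Q k x" "step_w P Q k x \<le> beta Q k" "step_w P Q k x * d \<le> w0 Q * gamma P Q k"
proof -
  define w where "w = step_w P Q k x"
  have d0: "0 \<le> d" by (simp add: x le_max_iff_disj)
  have w: "w = w0 Q * (if d = 0 then min 1 (beta Q k / w0 Q) else min 1 (min (gamma P Q k / d) (beta Q k / w0 Q)))"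
    unfolding w_def step_w_def x Let_def by simp
  have q: "0 \<le> beta Q k / w0 Q" using beta_pos[of k] params by simp
  have "0 \<le> gamma P Q k / d" using gamma_nonneg d0 by simp
  then show "0 \<le> w" unfolding w using q params by simp
  have "w \<le> w0 Q * (beta Q k / w0 Q)" unfolding w using params by (intro mult_left_mono) auto
  then show "w \<le> beta Q k" using params by simp
  show "w * d \<le> w0 Q * gamma P Q k"
  proof (cases "d = 0")
    case True
    then show ?thesis using params gamma_nonneg by simp
  next
    case False
    then have d: "0 < d" using d0 by simp
    have "w \<le> w0 Q * (gamma P Q k / d)" unfolding w using params False by (intro mult_left_mono) auto
    then have "w * d \<le> w0 Q * (gamma P Q k / d) * d" using d0 by (rule mult_right_mono)
    then show ?thesis using d by simp
  qed
qed

definition good_multipliers :: "nat \<Rightarrow> real ^ 'l \<Rightarrow> real ^ 'm \<Rightarrow> bool" where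
  "good_multipliers k y z \<longleftrightarrow>
     norm y \<le> multiplier_bound k \<and> (\<forall>j. 0 \<le> z $ j \<and> z $ j \<le> multiplier_bound k)"

text \<open>The primal part holds initially because \<open>R\<close> was chosen large, and later by the regularity
  condition.\<close>

definition good_state :: "nat \<Rightarrow> real ^ 'n \<Rightarrow> real ^ 'l \<Rightarrow> real ^ 'm \<Rightarrow> bool" where
  "good_state k x y z \<longleftrightarrow> good_multipliers k y z \<and> x \<in> edom (obj_h P) \<and>
     beta Q k * norm (r x) \<le> R \<and> beta Q k * norm (pos_part (f x)) \<le> R \<and> hr x \<le> h_bound"

lemma good_multipliersD:
  assumes "good_multipliers k y z"
  shows "norm y \<le> Y" "0 \<le> z $ j" "z $ j \<le> Y" "norm z \<le> m * Y"
proof -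
  show y: "norm y \<le> Y" and z: "0 \<le> z $ j" "z $ j \<le> Y" for j
    using assms multiplier_bound_le[of k] unfolding good_multipliers_def by (auto intro: order_trans)
  have "norm z \<le> (\<Sum>j\<in>UNIV. \<bar>z $ j\<bar>)" by (rule norm_le_l1_cart)
  also have "\<dots> \<le> (\<Sum>j\<in>(UNIV::'m set). Y)" using z by (intro sum_mono) simp
  finally show "norm z \<le> m * Y" by (simp add: m_eq)
qed

text \<open>The cap by \<open>\<beta>\<close> in the step size keeps \<open>z\<close> nonnegative, and the cap by \<open>\<gamma>\<close> limits the
  increments.\<close>

lemma good_multipliers_update:
  fixes x :: "real ^ 'n"
  assumes good: "good_multipliers k y z"
  defines "w \<equiv> step_w P Q k x"
  shows "good_multipliers (Suc k) (y + w *\<^sub>R r x) (\<chi> i. z $ i + w * max (- (z $ i) / beta Q k) (f x $ i))"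
  unfolding good_multipliers_def multiplier_bound_Suc
proof (intro conjI allI)
  define d where "d = max (norm (r x)) (norm (pos_part (f x)))"
  note w = step_w_bounds[OF d_def, of k, folded w_def]
  have "norm (y + w *\<^sub>R r x) \<le> norm y + w * norm (r x)"
    using norm_triangle_ineq[of y "w *\<^sub>R r x"] w(1) by simp
  also have "w * norm (r x) \<le> w * d" using w(1) by (intro mult_left_mono) (simp_all add: d_def)
  also have "w * d \<le> w0 Q * gamma P Q k" by (rule w(3))
  also have "norm y \<le> multiplier_bound k" using good by (simp add: good_multipliers_def)
  finally show "norm (y + w *\<^sub>R r x) \<le> multiplier_bound k + w0 Q * gamma P Q k" by simp
  fix j
  have z: "0 \<le> z $ j" "z $ j \<le> multiplier_bound k" using good by (auto simp: good_multipliers_def)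
  have "w * (z $ j / beta Q k) \<le> beta Q k * (z $ j / beta Q k)"
    using w(2) z beta_pos[of k] by (intro mult_right_mono) auto
  then have "w * (z $ j / beta Q k) \<le> z $ j" using beta_pos[of k] by simp
  moreover have "w * (- (z $ j) / beta Q k) \<le> w * max (- (z $ j) / beta Q k) (f x $ j)"
    using w(1) by (intro mult_left_mono) auto
  ultimately show "0 \<le> (\<chi> i. z $ i + w * max (- (z $ i) / beta Q k) (f x $ i)) $ j" by simp
  have "0 \<le> z $ j / beta Q k" using z(1) beta_pos[of k] by simp
  then have "max (- (z $ j) / beta Q k) (f x $ j) \<le> max 0 (f x $ j)" by auto
  also have "\<dots> \<le> d" using pos_part_le_norm[of "f x" j] by (simp add: d_def le_max_iff_disj)
  finally have "w * max (- (z $ j) / beta Q k) (f x $ j) \<le> w * d" using w(1) by (rule mult_left_mono)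
  with w(3) z(2)
  show "(\<chi> i. z $ i + w * max (- (z $ i) / beta Q k) (f x $ i)) $ j \<le> multiplier_bound k + w0 Q * gamma P Q k"
    by simp
qed

text \<open>Residuals of order \<open>1 / \<beta>\<close> contribute only \<open>\<beta> (1 / \<beta>)\<^sup>2 = 1 / \<beta>\<close> to the augmented
  Lagrangian. Hence its gap, and with it the number of proximal point steps, does not grow with
  the penalty.\<close>

lemma good_state_gap:
  assumes good: "good_state k x y z" and x': "x' \<in> edom (obj_h P)"
  shows "al_smooth P (beta Q k) y z x + hr x \<le> al_smooth P (beta Q k) y z x' + hr x' + \<Delta>"
proof -
  define \<beta> where "\<beta> = beta Q k"
  have b: "0 < \<beta>" "beta0 Q \<le> \<beta>" using beta_pos beta_ge by (auto simp: \<beta>_def)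
  have mult: "good_multipliers k y z" and x: "x \<in> edom (obj_h P)"
    and rx: "\<beta> * norm (r x) \<le> R" and fx: "\<beta> * norm (pos_part (f x)) \<le> R" and hx: "hr x \<le> h_bound"
    using good by (auto simp: good_state_def \<beta>_def)
  note yz = good_multipliersD[OF mult]
  have inner: "\<bar>y \<bullet> r u\<bar> \<le> Y * M" if "u \<in> edom (obj_h P)" for u
  proof -
    have "\<bar>y \<bullet> r u\<bar> \<le> norm y * norm (r u)" by (rule Cauchy_Schwarz_ineq2)
    also have "\<dots> \<le> Y * M" using yz(1) M_bounds[OF that] Y_nonneg by (intro mult_mono) auto
    finally show ?thesis .
  qed
  have inv: "1 / (2 * \<beta>) \<le> 1 / (2 * beta0 Q)" using b params by (intro divide_left_mono) auto
  have "\<beta> / 2 * (norm (r x))\<^sup>2 = 1 / (2 * \<beta>) * (\<beta> * norm (r x))\<^sup>2"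
    using b by (simp add: power2_eq_square)
  also have "\<dots> \<le> 1 / (2 * beta0 Q) * R\<^sup>2"
    using inv rx b params by (intro mult_mono power_mono) auto
  finally have quad: "\<beta> / 2 * (norm (r x))\<^sup>2 \<le> R\<^sup>2 / (2 * beta0 Q)" by simp
  have "norm (pos_part (z + \<beta> *\<^sub>R f x)) \<le> norm (\<beta> *\<^sub>R pos_part (f x)) + norm z"
    using norm_pos_part_diff_le[of \<beta> z "f x"] b
      norm_triangle_ineq2[of "pos_part (z + \<beta> *\<^sub>R f x)" "\<beta> *\<^sub>R pos_part (f x)"] by linarith
  then have pp: "norm (pos_part (z + \<beta> *\<^sub>R f x)) \<le> m * Y + R" using yz(4) fx b by simp
  have "1 / (2 * \<beta>) * ((norm (pos_part (z + \<beta> *\<^sub>R f x)))\<^sup>2 - (norm z)\<^sup>2)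
      \<le> 1 / (2 * \<beta>) * (norm (pos_part (z + \<beta> *\<^sub>R f x)))\<^sup>2" using b by (intro mult_left_mono) auto
  also have "\<dots> \<le> 1 / (2 * beta0 Q) * (m * Y + R)\<^sup>2"
    using inv pp params by (intro mult_mono power_mono) auto
  finally have pos: "1 / (2 * \<beta>) * ((norm (pos_part (z + \<beta> *\<^sub>R f x)))\<^sup>2 - (norm z)\<^sup>2)
      \<le> (m * Y + R)\<^sup>2 / (2 * beta0 Q)" by simp
  have up: "al_smooth P \<beta> y z x + hr x
      \<le> M + Y * M + R\<^sup>2 / (2 * beta0 Q) + (m * Y + R)\<^sup>2 / (2 * beta0 Q) + h_bound"
    unfolding al_smooth_def al_penalty_def
    using M_bounds[OF x] inner[OF x] quad pos hx by linarith
  have "1 / (2 * \<beta>) * (norm z)\<^sup>2 \<le> 1 / (2 * beta0 Q) * (m * Y)\<^sup>2"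
    using inv yz(4) params by (intro mult_mono power_mono) auto
  then have zz: "1 / (2 * \<beta>) * (norm z)\<^sup>2 \<le> (m * Y)\<^sup>2 / (2 * beta0 Q)" by simp
  have nn: "0 \<le> \<beta> / 2 * (norm (r x'))\<^sup>2" "0 \<le> 1 / (2 * \<beta>) * (norm (pos_part (z + \<beta> *\<^sub>R f x')))\<^sup>2"
    using b by auto
  have low: "- (M + Y * M + (m * Y)\<^sup>2 / (2 * beta0 Q) + M) \<le> al_smooth P \<beta> y z x' + hr x'"
    unfolding al_smooth_def al_penalty_def right_diff_distrib
    using M_bounds[OF x'] inner[OF x'] nn zz by linarith
  from up low show ?thesis unfolding \<Delta>_def \<beta>_def by linarith
qed

text \<open>Regularity turns stationarity into feasibility. The point whose distance it bounds from
  below is minus the gradient of the penalty without multipliers, divided by \<open>\<beta>\<close>; all else in the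
  stationarity residual is bounded independently of \<open>\<beta>\<close>.\<close>

lemma residual_bound:
  assumes mult: "good_multipliers k y z" and x: "x \<in> edom (obj_h P)"
    and w: "w \<in> subdiff (obj_h P) x" and st: "norm (grad (al_smooth P (beta Q k) y z) x + w) \<le> E"
    and reg: "regular_at P v (beta Q k) x"
  shows "beta Q k * norm (r x) \<le> C" "beta Q k * norm (pos_part (f x)) \<le> C"
proof -
  define \<beta> where "\<beta> = beta Q k"
  have b: "0 < \<beta>" using beta_pos by (simp add: \<beta>_def)
  note yz = good_multipliersD[OF mult]
  let ?a = "- (transpose A *v r x) - transpose (Jf P x) *v pos_part (f x)"
  let ?p = "pos_part (z + \<beta> *\<^sub>R f x)"
  have "dist_set ?a ((\<lambda>s. (1 / \<beta>) *\<^sub>R s) ` subdiff (obj_h P) x) \<le> ereal (norm (?a - (1 / \<beta>) *\<^sub>R w))"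
    unfolding dist_set_def by (rule INF_lower) (use w in blast)
  from order_trans[OF reg[unfolded regular_at_def, folded \<beta>_def] this]
  have le: "v * sqrt ((norm (r x))\<^sup>2 + (norm (pos_part (f x)))\<^sup>2) \<le> norm (?a - (1 / \<beta>) *\<^sub>R w)" by simp
  have lin: "transpose A *v (y + \<beta> *\<^sub>R r x) = transpose A *v y + \<beta> *\<^sub>R (transpose A *v r x)"
    by (simp add: linear_add[OF matrix_vector_mul_linear] linear_scale[OF matrix_vector_mul_linear])
  have linJ: "transpose (Jf P x) *v (?p - \<beta> *\<^sub>R pos_part (f x))
      = transpose (Jf P x) *v ?p - \<beta> *\<^sub>R (transpose (Jf P x) *v pos_part (f x))"
    by (simp add: linear_diff[OF matrix_vector_mul_linear] linear_scale[OF matrix_vector_mul_linear])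
  have id: "\<beta> *\<^sub>R (?a - (1 / \<beta>) *\<^sub>R w) = - (grad (al_smooth P \<beta> y z) x + w) + grad (obj_g P) x
      + transpose A *v y + transpose (Jf P x) *v (?p - \<beta> *\<^sub>R pos_part (f x))"
    unfolding linJ grad_al_smooth[OF b] al_grad_def lin using b by (simp add: scaleR_diff_right)
  have J: "norm (transpose (Jf P x) *v (?p - \<beta> *\<^sub>R pos_part (f x))) \<le> m * M * (m * Y)"
  proof -
    have "norm (transpose (Jf P x) *v (?p - \<beta> *\<^sub>R pos_part (f x))) \<le> m * M * norm (?p - \<beta> *\<^sub>R pos_part (f x))"
      using M_bounds[OF x] unfolding m_eq by (intro norm_transpose_Jf_le) auto
    also have "\<dots> \<le> m * M * (m * Y)"
      using norm_pos_part_diff_le[of \<beta> z "f x"] b yz(4) M_pos by (intro mult_left_mono) (auto simp: m_eq)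
    finally show ?thesis .
  qed
  have At: "norm (transpose A *v y) \<le> M * Y"
    using M_transpose[of y] mult_left_mono[OF yz(1), of M] M_pos by linarith
  have "\<beta> * norm (?a - (1 / \<beta>) *\<^sub>R w) = norm (\<beta> *\<^sub>R (?a - (1 / \<beta>) *\<^sub>R w))" using b by simp
  also have "\<dots> \<le> norm (- (grad (al_smooth P \<beta> y z) x + w)) + norm (grad (obj_g P) x)
      + norm (transpose A *v y) + norm (transpose (Jf P x) *v (?p - \<beta> *\<^sub>R pos_part (f x)))"
    unfolding id by (intro norm_triangle_mono order_refl)
  also have "\<dots> \<le> E + M + M * Y + m * M * (m * Y)"
    using st M_bounds[OF x] At J unfolding norm_minus_cancel \<beta>_def by linarith
  finally have "\<beta> * (v * sqrt ((norm (r x))\<^sup>2 + (norm (pos_part (f x)))\<^sup>2)) \<le> E + M + M * Y + m * M * (m * Y)"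
    using mult_left_mono[OF le, of \<beta>] b by linarith
  then have bound: "\<beta> * sqrt ((norm (r x))\<^sup>2 + (norm (pos_part (f x)))\<^sup>2) \<le> C"
    unfolding C_def using v_pos by (simp add: field_simps)
  have "norm (r x) \<le> sqrt ((norm (r x))\<^sup>2 + (norm (pos_part (f x)))\<^sup>2)"
    "norm (pos_part (f x)) \<le> sqrt ((norm (r x))\<^sup>2 + (norm (pos_part (f x)))\<^sup>2)"
    by (simp_all add: real_le_rsqrt)
  then have "\<beta> * norm (r x) \<le> \<beta> * sqrt ((norm (r x))\<^sup>2 + (norm (pos_part (f x)))\<^sup>2)"
    "\<beta> * norm (pos_part (f x)) \<le> \<beta> * sqrt ((norm (r x))\<^sup>2 + (norm (pos_part (f x)))\<^sup>2)"
    using b by (simp_all add: mult_left_mono)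
  with bound show "beta Q k * norm (r x) \<le> C" "beta Q k * norm (pos_part (f x)) \<le> C"
    unfolding \<beta>_def by linarith+
qed

text \<open>The function \<open>h\<close> may be unbounded on its domain, but not along the iterates: their
  stationarity provides bounded subgradients.\<close>

lemma h_bound_at_stationary:
  assumes mult: "good_multipliers k y z" and x: "x \<in> edom (obj_h P)"
    and w: "w \<in> subdiff (obj_h P) x" and st: "norm (grad (al_smooth P (beta Q k) y z) x + w) \<le> E"
    and rx: "beta Q k * norm (r x) \<le> C" and fx: "beta Q k * norm (pos_part (f x)) \<le> C"
  shows "hr x \<le> h_bound"
proof -
  define \<beta> where "\<beta> = beta Q k"
  have b: "0 < \<beta>" using beta_pos by (simp add: \<beta>_def)
  note yz = good_multipliersD[OF mult]
  let ?p = "pos_part (z + \<beta> *\<^sub>R f x)"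
  have "norm (y + \<beta> *\<^sub>R r x) \<le> norm y + \<beta> * norm (r x)"
    using norm_triangle_ineq[of y "\<beta> *\<^sub>R r x"] b by simp
  then have "norm (y + \<beta> *\<^sub>R r x) \<le> Y + C" using yz(1) rx unfolding \<beta>_def by linarith
  then have 1: "norm (transpose A *v (y + \<beta> *\<^sub>R r x)) \<le> M * (Y + C)"
    using M_transpose[of "y + \<beta> *\<^sub>R r x"] mult_left_mono[of "norm (y + \<beta> *\<^sub>R r x)" "Y + C" M] M_pos by linarith
  have "norm ?p \<le> norm (\<beta> *\<^sub>R pos_part (f x)) + norm z"
    using norm_pos_part_diff_le[of \<beta> z "f x"] b norm_triangle_ineq2[of ?p "\<beta> *\<^sub>R pos_part (f x)"] by linarith
  then have p: "norm ?p \<le> m * Y + C" using yz(4) fx b unfolding \<beta>_def by simp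
  have "norm (transpose (Jf P x) *v ?p) \<le> m * M * norm ?p"
    using M_bounds[OF x] unfolding m_eq by (intro norm_transpose_Jf_le) auto
  also have "\<dots> \<le> m * M * (m * Y + C)" using p M_pos by (intro mult_left_mono) (auto simp: m_eq)
  finally have 2: "norm (transpose (Jf P x) *v ?p) \<le> m * M * (m * Y + C)" .
  have "w = (grad (al_smooth P \<beta> y z) x + w) - grad (obj_g P) x - transpose A *v (y + \<beta> *\<^sub>R r x)
      - transpose (Jf P x) *v ?p"
    unfolding grad_al_smooth[OF b] al_grad_def by simp
  then have "norm w = norm ((grad (al_smooth P \<beta> y z) x + w) - grad (obj_g P) x
      - transpose A *v (y + \<beta> *\<^sub>R r x) - transpose (Jf P x) *v ?p)" by (rule arg_cong)
  also have "\<dots> \<le> norm (grad (al_smooth P \<beta> y z) x + w) + norm (grad (obj_g P) x)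
      + norm (transpose A *v (y + \<beta> *\<^sub>R r x)) + norm (transpose (Jf P x) *v ?p)"
    by (intro norm_triangle_le_diff add_right_mono order_refl)
  finally have nw: "norm w \<le> E + M + M * (Y + C) + m * M * (m * Y + C)"
    using st M_bounds[OF x] 1 2 unfolding \<beta>_def by linarith
  have "hr x + w \<bullet> (x_init Q - x) \<le> hr (x_init Q)" using w params(1) by (simp add: subdiff_iff)
  moreover have "- (w \<bullet> (x_init Q - x)) \<le> norm (x_init Q - x) * norm w"
    using norm_cauchy_schwarz[of "- w" "x_init Q - x"] by (simp add: mult.commute)
  moreover have "norm (x_init Q - x) * norm w \<le> M * (E + M + M * (Y + C) + m * M * (m * Y + C))"
    using nw M_diam[OF params(1) x] M_pos by (intro mult_mono) auto
  ultimately show ?thesis unfolding h_bound_def by linarith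
qed

text \<open>The KKT multipliers are the gradient weights \<open>y + \<beta> r\<close> and \<open>[z + \<beta> f]\<^sub>+\<close>. Where the
  second does not vanish, \<open>f\<close> is at least \<open>- z / \<beta>\<close>, which gives approximate
  complementarity.\<close>

lemma eps_KKT_if_penalty_large:
  assumes mult: "good_multipliers k y z" and x: "x \<in> edom (obj_h P)"
    and w: "w \<in> subdiff (obj_h P) x" and st: "norm (grad (al_smooth P (beta Q k) y z) x + w) \<le> \<epsilon>"
    and rx: "beta Q k * norm (r x) \<le> C" and fx: "beta Q k * norm (pos_part (f x)) \<le> C"
    and large: "C_KKT \<le> \<epsilon> * beta Q k"
  shows "eps_KKT P \<epsilon> x"
proof -
  define \<beta> where "\<beta> = beta Q k"
  have b: "0 < \<beta>" using beta_pos by (simp add: \<beta>_def)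
  note yz = good_multipliersD[OF mult]
  let ?y = "y + \<beta> *\<^sub>R r x" and ?z = "pos_part (z + \<beta> *\<^sub>R f x)"
  have mY: "0 \<le> m * (Y + C)\<^sup>2" by (simp add: m_eq)
  have "\<beta> * norm (r x) \<le> \<beta> * \<epsilon>" using rx large mY unfolding C_KKT_def \<beta>_def by (simp add: mult.commute)
  then have 1: "norm (r x) \<le> \<epsilon>" using b by simp
  let ?S = "(\<lambda>s. grad (obj_g P) x + s + transpose A *v ?y + transpose (Jf P x) *v ?z) ` subdiff (obj_h P) x"
  have "dist_set 0 ?S \<le> ereal (norm (0 - (grad (obj_g P) x + w + transpose A *v ?y + transpose (Jf P x) *v ?z)))"
    unfolding dist_set_def by (rule INF_lower) (use w in blast)
  also have "norm (0 - (grad (obj_g P) x + w + transpose A *v ?y + transpose (Jf P x) *v ?z))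
      = norm (grad (al_smooth P \<beta> y z) x + w)"
    unfolding grad_al_smooth[OF b] al_grad_def diff_0 norm_minus_cancel by (simp add: add_ac)
  also have "ereal \<dots> \<le> ereal \<epsilon>" using st by (simp add: \<beta>_def)
  finally have 2: "dist_set 0 ?S \<le> ereal \<epsilon>" .
  have comp: "\<beta> * \<bar>?z $ j * f x $ j\<bar> \<le> (Y + C)\<^sup>2" for j
  proof -
    have zj: "0 \<le> z $ j" "z $ j \<le> Y" using yz by auto
    show ?thesis
    proof (cases "0 \<le> f x $ j")
      case True
      then have bf: "0 \<le> \<beta> * f x $ j" using b by simp
      have "\<beta> * f x $ j \<le> \<beta> * norm (pos_part (f x))"
        using pos_part_le_norm[of "f x" j] True b by (intro mult_left_mono) auto
      then have bC: "\<beta> * f x $ j \<le> C" using fx unfolding \<beta>_def by linarith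
      have "\<beta> * \<bar>?z $ j * f x $ j\<bar> = (z $ j + \<beta> * f x $ j) * (\<beta> * f x $ j)"
        using True bf zj by (simp add: pos_part_def abs_mult)
      also have "\<dots> \<le> (Y + C) * (Y + C)"
        using bf bC zj Y_nonneg by (intro mult_mono) auto
      finally show ?thesis by (simp add: power2_eq_square)
    next
      case False
      show ?thesis
      proof (cases "0 < z $ j + \<beta> * f x $ j")
        case True
        have neg: "\<beta> * f x $ j \<le> 0" using False b by (simp add: mult_nonneg_nonpos)
        have "\<beta> * \<bar>?z $ j * f x $ j\<bar> = (z $ j + \<beta> * f x $ j) * (- (\<beta> * f x $ j))"
          using True False by (simp add: pos_part_def abs_mult)
        also have "\<dots> \<le> (Y + C) * (Y + C)"
          using neg True zj Y_nonneg C_nonneg by (intro mult_mono) auto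
        finally show ?thesis by (simp add: power2_eq_square)
      qed (simp add: pos_part_def max_def)
    qed
  qed
  have "\<beta> * (\<Sum>j\<in>UNIV. \<bar>?z $ j * f x $ j\<bar>) \<le> (\<Sum>j\<in>(UNIV::'m set). (Y + C)\<^sup>2)"
    unfolding sum_distrib_left by (rule sum_mono) (rule comp)
  also have "\<dots> \<le> \<beta> * \<epsilon>" using large C_nonneg unfolding C_KKT_def \<beta>_def by (simp add: m_eq mult.commute)
  finally have 3: "(\<Sum>j\<in>UNIV. \<bar>?z $ j * f x $ j\<bar>) \<le> \<epsilon>" using b by simp
  show ?thesis
    unfolding eps_KKT_def by (rule exI[of _ ?y], rule exI[of _ ?z], intro conjI 1 2 3)
qed

end

section \<open>Complexity of the outer iteration\<close>

lemma apg_bound_nonneg: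
  assumes "0 \<le> \<mu>" "0 \<le> L"
  shows "0 \<le> apg_bound \<mu> L D \<epsilon>"
  unfolding apg_bound_def using assms by (intro add_nonneg_nonneg mult_nonneg_nonneg) auto

lemma apg_bound_mono:
  assumes mu: "0 < \<mu>" and L: "0 < L" "L \<le> L'" and D: "0 < D" and eps: "0 < \<epsilon>"
  shows "apg_bound \<mu> L D \<epsilon> \<le> apg_bound \<mu> L' D \<epsilon>"
proof -
  define a where "a = sqrt (\<mu> / L)"
  define a' where "a' = sqrt (\<mu> / L')"
  have L': "0 < L'" using L by linarith
  have a': "0 < a'" using mu L' by (simp add: a'_def)
  have "\<mu> / L' \<le> \<mu> / L" using mu L L' by (intro divide_left_mono) auto
  then have aa: "a' \<le> a" unfolding a_def a'_def by (rule real_sqrt_le_mono)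
  have a: "0 < a" using a' aa by linarith
  have 1: "2 / a \<le> 2 / a'" using aa a a' by (intro divide_left_mono) auto
  have "4 * L * D / (a * \<epsilon>) \<le> 4 * L' * D / (a' * \<epsilon>)"
    using L L' D a a' aa eps by (intro frac_le mult_mono mult_pos_pos mult_nonneg_nonneg) auto
  moreover have "0 < 4 * L * D / (a * \<epsilon>)" using L D a eps by simp
  ultimately have "ln (4 * L * D / (a * \<epsilon>)) \<le> ln (4 * L' * D / (a' * \<epsilon>))" by (intro ln_mono) auto
  then have 2: "max 0 (ln (4 * L * D / (a * \<epsilon>))) \<le> max 0 (ln (4 * L' * D / (a' * \<epsilon>)))" by auto
  have "2 / a * max 0 (ln (4 * L * D / (a * \<epsilon>))) \<le> 2 / a' * max 0 (ln (4 * L' * D / (a' * \<epsilon>)))"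
    using 1 2 a' by (intro mult_mono) auto
  then show ?thesis unfolding apg_bound_def a_def a'_def by simp
qed

context ialm_constants
begin

definition call_bound :: "real \<Rightarrow> real \<Rightarrow> real" where
  "call_bound \<epsilon> L = (1 + 32 * rho0 P * \<Delta> / \<epsilon>\<^sup>2) * apg_bound (rho0 P) L M (\<epsilon> / 4)"

lemma good_initial_state: "good_state 0 (x_init Q) 0 0"
proof -
  have "0 \<le> M * (E + M + M * (Y + C) + m * M * (m * Y + C))"
    using M_pos E_pos Y_nonneg C_nonneg by (simp add: m_eq)
  moreover have "beta0 Q * norm (r (x_init Q)) \<le> R" "beta0 Q * norm (pos_part (f (x_init Q))) \<le> R"
    unfolding R_def by (rule max.coboundedI2, rule mult_left_mono, simp, simp add: params less_imp_le)+
  ultimately show ?thesis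
    using params by (simp add: good_state_def good_multipliers_def multiplier_bound_def h_bound_def beta_def)
qed

lemma \<Delta>_nonneg: "0 \<le> \<Delta>"
  using good_state_gap[OF good_initial_state params(1)] by simp

context
  fixes \<epsilon> :: real and s :: "nat \<Rightarrow> nat \<Rightarrow> real ^ 'n"
  assumes eps: "0 < \<epsilon>" "\<epsilon> \<le> E" and s_dom: "\<And>k j. s k j \<in> edom (obj_h P)"
    and inputs: "ialm_smooth_inputs P Q \<epsilon> s"
    and regular: "\<And>k. k \<ge> 1 \<Longrightarrow> ialm_cost P Q \<epsilon> s k \<noteq> \<infinity> \<Longrightarrow>
      regular_at P v (beta Q (k - 1)) (ialm_x P Q \<epsilon> s k)"
begin

definition call_cost :: "nat \<Rightarrow> enat" where
  "call_cost k = (let (x, y, z) = ialm P Q \<epsilon> s k; \<beta> = beta Q k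
     in ippm_cost (al_smooth P \<beta> y z) (obj_h P) x (rho0 P) (Lhat P \<beta> z) \<epsilon> (s k))"

lemma ialm_cost_eq: "ialm_cost P Q \<epsilon> s K = (\<Sum>k<K. call_cost k)"
  by (simp add: ialm_cost_def call_cost_def)

text \<open>One outer iteration. The gap bound in the state before it makes iPPM terminate in time; the
  regularity condition at the point it returns re-establishes the invariant.\<close>

lemma ialm_step:
  assumes state: "ialm P Q \<epsilon> s k = (x, y, z)" and good: "good_state k x y z"
    and fin: "ialm_cost P Q \<epsilon> s k \<noteq> \<infinity>"
  shows "\<exists>N. call_cost k = enat N \<and> real N \<le> call_bound \<epsilon> (Lhat P (beta Q k) z + 2 * rho0 P)"
    and "\<exists>x' y' z'. ialm P Q \<epsilon> s (Suc k) = (x', y', z') \<and> good_state (Suc k) x' y' z' \<and>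
      (C_KKT \<le> \<epsilon> * beta Q k \<longrightarrow> eps_KKT P \<epsilon> x')"
proof -
  define \<beta> where "\<beta> = beta Q k"
  have b: "0 < \<beta>" using beta_pos by (simp add: \<beta>_def)
  have mult: "good_multipliers k y z" and x: "x \<in> edom (obj_h P)" using good by (auto simp: good_state_def)
  have inp: "ippm_smooth_inputs (al_smooth P \<beta> y z) (obj_h P) x (rho0 P) (Lhat P \<beta> z) \<epsilon> (s k)"
    using inputs fin unfolding ialm_smooth_inputs_def \<beta>_def by (auto simp: state Let_def dest: spec[of _ k])
  interpret I: ippm "obj_h P" "al_smooth P \<beta> y z" "rho0 P" "Lhat P \<beta> z" M \<epsilon> \<Delta> x "s k"
  proof unfold_locales
    show "al_smooth P \<beta> y z differentiable at u" for u by (rule al_smooth_differentiable[OF b])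
    show "quad_below (- rho0 P) (al_smooth P \<beta> y z)" by (rule al_smooth_quad_below[OF b])
    show "0 \<le> Lhat P \<beta> z" using b by (intro Lhat_nonneg) simp
    show "al_smooth P \<beta> y z x + hr x \<le> al_smooth P \<beta> y z u + hr u + \<Delta>" if "u \<in> edom (obj_h P)" for u
      unfolding \<beta>_def by (rule good_state_gap[OF good that])
  qed (use rho_pos eps M_pos M_diam x s_dom inp in auto)
  define x' where "x' = ippm_out (al_smooth P \<beta> y z) (obj_h P) x (rho0 P) (Lhat P \<beta> z) \<epsilon> (s k)"
  obtain N where N: "ippm_cost (al_smooth P \<beta> y z) (obj_h P) x (rho0 P) (Lhat P \<beta> z) \<epsilon> (s k) = enat N"
    "real N \<le> (1 + 32 * rho0 P * \<Delta> / \<epsilon>\<^sup>2) * apg_bound (rho0 P) (Lhat P \<beta> z + 2 * rho0 P) M (\<epsilon> / 4)"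
    "x' \<in> edom (obj_h P)"
    "\<exists>w\<in>subdiff (obj_h P) x'. norm (grad (al_smooth P \<beta> y z) x' + w) < \<epsilon>"
    unfolding x'_def by (rule I.ippm_terminates)
  have cost: "call_cost k = enat N"
    using N(1) by (simp add: call_cost_def state Let_def \<beta>_def)
  with N(2) show "\<exists>N. call_cost k = enat N \<and> real N \<le> call_bound \<epsilon> (Lhat P (beta Q k) z + 2 * rho0 P)"
    unfolding call_bound_def \<beta>_def by blast
  obtain w where w: "w \<in> subdiff (obj_h P) x'" "norm (grad (al_smooth P \<beta> y z) x' + w) < \<epsilon>"
    using N(4) by blast
  have w\<epsilon>: "norm (grad (al_smooth P (beta Q k) y z) x' + w) \<le> \<epsilon>"
    and wE: "norm (grad (al_smooth P (beta Q k) y z) x' + w) \<le> E" using w(2) eps by (auto simp: \<beta>_def)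
  define y' where "y' = y + step_w P Q k x' *\<^sub>R r x'"
  define z' where "z' = (\<chi> i. z $ i + step_w P Q k x' * max (- (z $ i) / beta Q k) (f x' $ i))"
  have next_state: "ialm P Q \<epsilon> s (Suc k) = (x', y', z')"
    by (simp add: state Let_def x'_def y'_def z'_def \<beta>_def)
  have "ialm_cost P Q \<epsilon> s (Suc k) = ialm_cost P Q \<epsilon> s k + enat N"
    by (simp add: ialm_cost_eq cost)
  then have "ialm_cost P Q \<epsilon> s (Suc k) \<noteq> \<infinity>" using fin by (cases "ialm_cost P Q \<epsilon> s k") auto
  from regular[OF _ this] have reg: "regular_at P v (beta Q k) x'"
    by (simp add: ialm_x_def next_state del: ialm.simps)
  note res = residual_bound[OF mult N(3) w(1) wE reg]
  have "sigma Q * (beta Q k * norm (r x')) \<le> sigma Q * C"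
    "sigma Q * (beta Q k * norm (pos_part (f x'))) \<le> sigma Q * C"
    using res params(3) by (intro mult_left_mono; simp)+
  then have "beta Q (Suc k) * norm (r x') \<le> R" "beta Q (Suc k) * norm (pos_part (f x')) \<le> R"
    unfolding R_def beta_Suc by (auto simp: mult.assoc intro: max.coboundedI1)
  moreover have "good_multipliers (Suc k) y' z'"
    unfolding y'_def z'_def by (rule good_multipliers_update[OF mult])
  moreover have "hr x' \<le> h_bound"
    by (rule h_bound_at_stationary[OF mult N(3) w(1) wE res])
  ultimately have "good_state (Suc k) x' y' z'" using N(3) by (simp add: good_state_def)
  moreover have "C_KKT \<le> \<epsilon> * beta Q k \<longrightarrow> eps_KKT P \<epsilon> x'"
    using eps_KKT_if_penalty_large[OF mult N(3) w(1) w\<epsilon> res] by blast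
  ultimately show "\<exists>x' y' z'. ialm P Q \<epsilon> s (Suc k) = (x', y', z') \<and> good_state (Suc k) x' y' z' \<and>
      (C_KKT \<le> \<epsilon> * beta Q k \<longrightarrow> eps_KKT P \<epsilon> x')"
    using next_state by blast
qed

lemma ialm_invariant:
  "\<exists>x y z. ialm P Q \<epsilon> s k = (x, y, z) \<and> good_state k x y z \<and> ialm_cost P Q \<epsilon> s k \<noteq> \<infinity>"
proof (induction k)
  case 0
  then show ?case using good_initial_state by (simp add: ialm_cost_def)
next
  case (Suc k)
  then obtain x y z where *: "ialm P Q \<epsilon> s k = (x, y, z)" "good_state k x y z" "ialm_cost P Q \<epsilon> s k \<noteq> \<infinity>"
    by blast
  obtain N where "call_cost k = enat N" using ialm_step(1)[OF *] by blast
  then have "ialm_cost P Q \<epsilon> s (Suc k) \<noteq> \<infinity>"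
    using *(3) by (cases "ialm_cost P Q \<epsilon> s k") (simp_all add: ialm_cost_eq)
  then show ?case using ialm_step(2)[OF *] by blast
qed

lemma ialm_produces_KKT:
  assumes large: "C_KKT \<le> \<epsilon> * beta Q k"
  shows "eps_KKT P \<epsilon> (ialm_x P Q \<epsilon> s (Suc k))"
proof -
  obtain x y z where *: "ialm P Q \<epsilon> s k = (x, y, z)" "good_state k x y z" "ialm_cost P Q \<epsilon> s k \<noteq> \<infinity>"
    using ialm_invariant by blast
  from ialm_step(2)[OF *] large obtain x' y' z' where "ialm P Q \<epsilon> s (Suc k) = (x', y', z')" "eps_KKT P \<epsilon> x'"
    by blast
  then show ?thesis by (simp add: ialm_x_def del: ialm.simps)
qed

lemma ialm_cost_bound:
  assumes L: "\<And>k z. k < K \<Longrightarrow> (\<And>i. \<bar>z $ i\<bar> \<le> Y) \<Longrightarrow> Lhat P (beta Q k) z + 2 * rho0 P \<le> L"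
  shows "\<exists>N. ialm_cost P Q \<epsilon> s K = enat N \<and> real N \<le> real K * call_bound \<epsilon> L"
  unfolding ialm_cost_eq
proof (rule sum_enat_bounded)
  fix k assume k: "k < K"
  obtain x y z where *: "ialm P Q \<epsilon> s k = (x, y, z)" "good_state k x y z" "ialm_cost P Q \<epsilon> s k \<noteq> \<infinity>"
    using ialm_invariant by blast
  obtain N where N: "call_cost k = enat N" "real N \<le> call_bound \<epsilon> (Lhat P (beta Q k) z + 2 * rho0 P)"
    using ialm_step(1)[OF *] by blast
  have mult: "good_multipliers k y z" using *(2) by (simp add: good_state_def)
  have le: "Lhat P (beta Q k) z + 2 * rho0 P \<le> L"
    by (rule L[OF k]) (use good_multipliersD[OF mult] in auto)
  have "0 \<le> Lhat P (beta Q k) z" using beta_pos[of k] by (intro Lhat_nonneg) simp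
  then have "apg_bound (rho0 P) (Lhat P (beta Q k) z + 2 * rho0 P) M (\<epsilon> / 4) \<le> apg_bound (rho0 P) L M (\<epsilon> / 4)"
    using rho_pos M_pos eps le by (intro apg_bound_mono) auto
  then have "call_bound \<epsilon> (Lhat P (beta Q k) z + 2 * rho0 P) \<le> call_bound \<epsilon> L"
    unfolding call_bound_def using rho_pos \<Delta>_nonneg by (intro mult_left_mono add_nonneg_nonneg) auto
  with N show "\<exists>N. call_cost k = enat N \<and> real N \<le> call_bound \<epsilon> L" by fastforce
qed

end

lemma C_KKT_pos: "0 < C_KKT"
proof -
  have "0 < C"
    unfolding C_def using E_pos M_pos Y_nonneg v_pos
    by (intro divide_pos_pos add_pos_nonneg) (auto simp: m_eq)
  moreover have "0 \<le> m * (Y + C)\<^sup>2" by (simp add: m_eq)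
  ultimately show ?thesis unfolding C_KKT_def by linarith
qed

text \<open>Since the penalty grows geometrically, it exceeds \<open>C_KKT / \<epsilon>\<close> after logarithmically
  many steps. Unless the initial penalty is large enough already, it overshoots at most by the
  factor \<open>\<sigma>\<close>.\<close>

lemma penalty_large_enough:
  assumes eps: "0 < \<epsilon>" "\<epsilon> \<le> E"
  obtains k where "C_KKT \<le> \<epsilon> * beta Q k" "beta Q k \<le> (beta0 Q * E + sigma Q * C_KKT) / \<epsilon>"
    "real k \<le> 1 + max 0 (log (sigma Q) (C_KKT / beta0 Q / \<epsilon>))"
proof -
  define l where "l = log (sigma Q) (C_KKT / beta0 Q / \<epsilon>)"
  define k where "k = nat \<lceil>l\<rceil>"
  have arg: "0 < C_KKT / beta0 Q / \<epsilon>" using C_KKT_pos params eps by simp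
  have pl: "sigma Q powr l = C_KKT / beta0 Q / \<epsilon>"
    unfolding l_def using arg params by (intro powr_log_cancel) auto
  have pk: "sigma Q ^ k = sigma Q powr real k" using params by (simp add: powr_realpow)
  have "l \<le> real k" unfolding k_def by linarith
  then have "C_KKT / beta0 Q / \<epsilon> \<le> sigma Q ^ k"
    unfolding pk pl[symmetric] using params by (intro powr_mono) auto
  then have 1: "C_KKT \<le> \<epsilon> * beta Q k" using params eps by (simp add: beta_def field_simps)
  have 2: "beta Q k \<le> (beta0 Q * E + sigma Q * C_KKT) / \<epsilon>"
  proof (cases "l \<le> 0")
    case True
    then have "k = 0" by (simp add: k_def)
    then have "\<epsilon> * beta Q k \<le> beta0 Q * E" using params eps by (simp add: beta_def mult.commute)
    also have "\<dots> \<le> beta0 Q * E + sigma Q * C_KKT" using params C_KKT_pos by simp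
    finally show ?thesis using eps by (simp add: field_simps)
  next
    case False
    then have "real k \<le> l + 1" unfolding k_def by linarith
    then have "sigma Q ^ k \<le> sigma Q powr (l + 1)" unfolding pk using params by (intro powr_mono) auto
    also have "\<dots> = C_KKT / beta0 Q / \<epsilon> * sigma Q" using params by (simp add: powr_add pl)
    finally have "beta Q k \<le> beta0 Q * (C_KKT / beta0 Q / \<epsilon> * sigma Q)"
      unfolding beta_def using params by (intro mult_left_mono) auto
    also have "\<dots> = sigma Q * C_KKT / \<epsilon>" using params by simp
    also have "\<dots> \<le> (beta0 Q * E + sigma Q * C_KKT) / \<epsilon>"
      using params E_pos eps by (intro divide_right_mono) auto
    finally show ?thesis .
  qed
  have "real k \<le> 1 + max 0 l" unfolding k_def by linarith
  with 1 2 show ?thesis unfolding l_def by (rule that)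
qed

end

text \<open>The three factors bound the numbers of outer iterations, of proximal point steps per outer
  iteration, and of APG iterations per proximal point step.\<close>

lemma soft_O_total:
  fixes c1 c2 c \<rho> M \<sigma> :: real
  assumes "c1 > 0" "\<sigma> > 1" "c > 0" "\<rho> > 0" "M > 0"
  shows "(\<lambda>\<epsilon>. (2 + max 0 (log \<sigma> (c1 / \<epsilon>))) * ((1 + c2 / \<epsilon>\<^sup>2) * apg_bound \<rho> (c / \<epsilon>) M (\<epsilon> / 4)))
    \<in> soft_O (\<lambda>\<epsilon>. \<epsilon> powr (- 5 / 2))"
proof -
  have 1: "(\<lambda>\<epsilon>::real. 2 + max 0 (log \<sigma> (c1 / \<epsilon>))) \<in> O[at_right 0](\<lambda>\<epsilon>. ln (1 / \<epsilon>))"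
    using assms by real_asymp
  have 2: "(\<lambda>\<epsilon>::real. 1 + c2 / \<epsilon>\<^sup>2) \<in> O[at_right 0](\<lambda>\<epsilon>. \<epsilon> powr (- 2))"
    by real_asymp
  have 3: "(\<lambda>\<epsilon>. apg_bound \<rho> (c / \<epsilon>) M (\<epsilon> / 4)) \<in> O[at_right 0](\<lambda>\<epsilon>. \<epsilon> powr (- 1 / 2) * ln (1 / \<epsilon>))"
    unfolding apg_bound_def using assms by real_asymp
  have "(\<lambda>\<epsilon>::real. ln (1 / \<epsilon>) * (\<epsilon> powr (- 2) * (\<epsilon> powr (- 1 / 2) * ln (1 / \<epsilon>))))
      = (\<lambda>\<epsilon>. \<epsilon> powr (- 5 / 2) * ln (1 / \<epsilon>) ^ 2)"
    by (rule ext) (simp add: power2_eq_square mult_ac flip: powr_add)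
  with landau_o.big.mult[OF 1 landau_o.big.mult[OF 2 3]]
  show ?thesis unfolding soft_O_def by auto
qed

context ialm_constants
begin

lemma ialm_complexity:
  "\<exists>T\<in>soft_O (\<lambda>\<epsilon>. \<epsilon> powr (- 5 / 2)). \<forall>\<epsilon> s. 0 < \<epsilon> \<longrightarrow> \<epsilon> \<le> E \<longrightarrow>
     (\<forall>k j. s k j \<in> edom (obj_h P)) \<longrightarrow> ialm_smooth_inputs P Q \<epsilon> s \<longrightarrow>
     (\<forall>k\<ge>1. ialm_cost P Q \<epsilon> s k \<noteq> \<infinity> \<longrightarrow> regular_at P v (beta Q (k - 1)) (ialm_x P Q \<epsilon> s k)) \<longrightarrow>
     (\<exists>K\<ge>1. \<exists>N. ialm_cost P Q \<epsilon> s K = enat N \<and> real N \<le> T \<epsilon> \<and> eps_KKT P \<epsilon> (ialm_x P Q \<epsilon> s K))"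
proof -
  obtain a b where ab: "0 \<le> a" "0 \<le> b"
    and Lhat_le: "\<And>\<beta> z. (\<And>i. \<bar>z $ i\<bar> \<le> Y) \<Longrightarrow> Lhat P \<beta> z \<le> a + b * \<beta>"
    using Lhat_le_affine[of Y] by blast
  define c where "c = (a + 2 * rho0 P) * E + b * (beta0 Q * E + sigma Q * C_KKT)"
  have c: "0 < c"
    unfolding c_def using ab rho_pos E_pos params C_KKT_pos by (intro add_pos_nonneg) auto
  define T where "T \<epsilon> = (2 + max 0 (log (sigma Q) (C_KKT / beta0 Q / \<epsilon>))) *
    ((1 + 32 * rho0 P * \<Delta> / \<epsilon>\<^sup>2) * apg_bound (rho0 P) (c / \<epsilon>) M (\<epsilon> / 4))" for \<epsilon>
  have "T \<in> soft_O (\<lambda>\<epsilon>. \<epsilon> powr (- 5 / 2))"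
    unfolding T_def[abs_def] using C_KKT_pos params c rho_pos M_pos by (intro soft_O_total) auto
  moreover have "\<exists>K\<ge>1. \<exists>N. ialm_cost P Q \<epsilon> s K = enat N \<and> real N \<le> T \<epsilon> \<and> eps_KKT P \<epsilon> (ialm_x P Q \<epsilon> s K)"
    if eps: "0 < \<epsilon>" "\<epsilon> \<le> E" and s: "\<forall>k j. s k j \<in> edom (obj_h P)" and inp: "ialm_smooth_inputs P Q \<epsilon> s"
      and reg: "\<forall>k\<ge>1. ialm_cost P Q \<epsilon> s k \<noteq> \<infinity> \<longrightarrow> regular_at P v (beta Q (k - 1)) (ialm_x P Q \<epsilon> s k)"
    for \<epsilon> s
  proof -
    obtain k where k: "C_KKT \<le> \<epsilon> * beta Q k" "beta Q k \<le> (beta0 Q * E + sigma Q * C_KKT) / \<epsilon>"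
      "real k \<le> 1 + max 0 (log (sigma Q) (C_KKT / beta0 Q / \<epsilon>))"
      by (rule penalty_large_enough[OF eps])
    have L: "Lhat P (beta Q i) z + 2 * rho0 P \<le> c / \<epsilon>" if "i < Suc k" "\<And>j. \<bar>z $ j\<bar> \<le> Y" for i z
    proof -
      have "Lhat P (beta Q i) z \<le> a + b * beta Q i" by (rule Lhat_le[OF that(2)])
      also have "b * beta Q i \<le> b * ((beta0 Q * E + sigma Q * C_KKT) / \<epsilon>)"
        using ab beta_mono[of i k] that(1) k(2) by (intro mult_left_mono) auto
      finally have "Lhat P (beta Q i) z + 2 * rho0 P
          \<le> (a + 2 * rho0 P) * 1 + b * (beta0 Q * E + sigma Q * C_KKT) / \<epsilon>" by simp
      also have "(a + 2 * rho0 P) * 1 \<le> (a + 2 * rho0 P) * (E / \<epsilon>)"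
        using ab rho_pos eps by (intro mult_left_mono) auto
      finally show ?thesis unfolding c_def by (simp add: add_divide_distrib)
    qed
    obtain N where N: "ialm_cost P Q \<epsilon> s (Suc k) = enat N" "real N \<le> real (Suc k) * call_bound \<epsilon> (c / \<epsilon>)"
      using ialm_cost_bound[OF eps _ inp _ L] s reg by blast
    have "0 \<le> call_bound \<epsilon> (c / \<epsilon>)"
      unfolding call_bound_def using rho_pos \<Delta>_nonneg c eps
      by (intro mult_nonneg_nonneg add_nonneg_nonneg apg_bound_nonneg) auto
    then have "real (Suc k) * call_bound \<epsilon> (c / \<epsilon>) \<le> T \<epsilon>"
      unfolding T_def call_bound_def[symmetric] using k(3) by (intro mult_right_mono) auto
    then have "real N \<le> T \<epsilon>" using N(2) by linarith
    moreover have "eps_KKT P \<epsilon> (ialm_x P Q \<epsilon> s (Suc k))"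
      using ialm_produces_KKT[OF eps _ inp _ k(1)] s reg by blast
    ultimately show ?thesis using N(1) by (intro exI[of _ "Suc k"]) auto
  qed
  ultimately show ?thesis by blast
qed

end

lemma soft_O_cong:
  assumes "T \<in> soft_O g" and "\<forall>\<^sub>F \<epsilon> in at_right 0. T \<epsilon> = T' \<epsilon>"
  shows "T' \<in> soft_O g"
  using assms landau_o.big.in_cong[OF assms(2)] unfolding soft_O_def by auto

theorem theorem4:
  fixes P :: "('n::finite, 'l::finite, 'm::finite) problem"
    and Q :: "'n params"
    and v :: real
  assumes g_C1: "\<forall>x. obj_g P differentiable at x" "continuous_on UNIV (grad (obj_g P))"
    and f_convex: "\<forall>j. convex_on UNIV (\<lambda>x. con_f P x $ j)"
    and f_smooth: "\<forall>j. L_smooth_on (Lf P j) UNIV (\<lambda>x. con_f P x $ j)"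
    and g_smooth: "L_smooth_on (L0 P) UNIV (obj_g P)"
    and g_weakly_convex: "rho0 P > 0" "weakly_convex (rho0 P) (obj_g P)"
    and h_convex: "closed_convex_fun (obj_h P)"
    and h_dom: "compact (edom (obj_h P))"
    and params: "x_init Q \<in> edom (obj_h P)" "beta0 Q > 0" "sigma Q > 1" "w0 Q > 0"
    and v_pos: "v > 0"
  shows "\<exists>T. T \<in> soft_O (\<lambda>\<epsilon>. \<epsilon> powr (- 5 / 2)) \<and>
    (\<forall>\<epsilon>>0. \<forall>s.
       (\<forall>k j. s k j \<in> edom (obj_h P)) \<longrightarrow>
       ialm_smooth_inputs P Q \<epsilon> s \<longrightarrow>
       (\<forall>k\<ge>1. ialm_cost P Q \<epsilon> s k \<noteq> \<infinity> \<longrightarrow> regular_at P v (beta Q (k - 1)) (ialm_x P Q \<epsilon> s k)) \<longrightarrow>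
       (\<exists>K\<ge>1. \<exists>N. ialm_cost P Q \<epsilon> s K = enat N \<and> real N \<le> T \<epsilon> \<and>
                 eps_KKT P \<epsilon> (ialm_x P Q \<epsilon> s K)))"
proof -
  interpret convex_constrained_problem P
    by unfold_locales (use assms in auto)
  obtain M where M: "0 < M"
    "\<And>x. x \<in> edom (obj_h P) \<Longrightarrow> \<bar>obj_g P x\<bar> \<le> M \<and> norm (grad (obj_g P) x) \<le> M \<and> norm (r x) \<le> M
       \<and> (\<forall>j. \<bar>f x $ j\<bar> \<le> M \<and> norm (df j x) \<le> M) \<and> - M \<le> hr x"
    "\<And>x y. x \<in> edom (obj_h P) \<Longrightarrow> y \<in> edom (obj_h P) \<Longrightarrow> norm (x - y) \<le> M"
    "\<And>u. norm (transpose A *v u) \<le> M * norm u"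
    by (rule uniform_bounds, rule that)
  let ?good = "\<lambda>\<epsilon> t. \<forall>s. (\<forall>k j. s k j \<in> edom (obj_h P)) \<longrightarrow> ialm_smooth_inputs P Q \<epsilon> s \<longrightarrow>
     (\<forall>k\<ge>1. ialm_cost P Q \<epsilon> s k \<noteq> \<infinity> \<longrightarrow> regular_at P v (beta Q (k - 1)) (ialm_x P Q \<epsilon> s k)) \<longrightarrow>
     (\<exists>K\<ge>1. \<exists>N. ialm_cost P Q \<epsilon> s K = enat N \<and> real N \<le> t \<and> eps_KKT P \<epsilon> (ialm_x P Q \<epsilon> s K))"
  have main: "\<exists>T\<in>soft_O (\<lambda>\<epsilon>. \<epsilon> powr (- 5 / 2)). \<forall>\<epsilon>. 0 < \<epsilon> \<longrightarrow> \<epsilon> \<le> E \<longrightarrow> ?good \<epsilon> (T \<epsilon>)" if "0 < E" for E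
  proof -
    interpret ialm_constants P Q v E M "real CARD('m)"
      by unfold_locales (use params v_pos that M in auto)
    show ?thesis using ialm_complexity by blast
  qed
  obtain T1 where T1: "T1 \<in> soft_O (\<lambda>\<epsilon>. \<epsilon> powr (- 5 / 2))" "\<forall>\<epsilon>. 0 < \<epsilon> \<longrightarrow> \<epsilon> \<le> 1 \<longrightarrow> ?good \<epsilon> (T1 \<epsilon>)"
    using main[of 1] by auto
  have "\<exists>t. ?good E t" if "0 < E" for E using main[OF that] that by blast
  then obtain T2 where T2: "\<And>\<epsilon>. 0 < \<epsilon> \<Longrightarrow> ?good \<epsilon> (T2 \<epsilon>)" by metis
  \<comment> \<open>The constants are uniform only for bounded \<open>\<epsilon>\<close>. The asymptotics concern \<open>\<epsilon> \<le> 1\<close>, and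
    each larger \<open>\<epsilon>\<close> gets a bound of its own.\<close>
  define T where "T \<epsilon> = (if \<epsilon> \<le> 1 then T1 \<epsilon> else T2 \<epsilon>)" for \<epsilon>
  have "\<forall>\<^sub>F \<epsilon> in at_right 0. T1 \<epsilon> = T \<epsilon>"
    by (rule eventually_mono[OF eventually_at_right_real[OF zero_less_one]]) (auto simp: T_def)
  with T1(1) have "T \<in> soft_O (\<lambda>\<epsilon>. \<epsilon> powr (- 5 / 2))" by (rule soft_O_cong)
  moreover have "?good \<epsilon> (T \<epsilon>)" if "0 < \<epsilon>" for \<epsilon>
    using T1(2) T2 that unfolding T_def by (cases "\<epsilon> \<le> 1") simp_all
  ultimately show ?thesis by blast
qed

end
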